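(* Let $X$ and $Y$ be independent, positive, non-degenerate random variables. For a fixed $r\in\mathbb{R}$ assume that: (1) if $r\ge 1$, then $\mathbb{E}X^{r+1}<\infty$ and $\mathbb{E}Y^{r+1}<\infty$; (2) if $r\in(-1,1)$, then $\mathbb{E}X^{r+1}<\infty$, $\mathbb{E}Y^{r+1}<\infty$, $\mathbb{E}X^{r-1}<\infty$ and $\mathbb{E}Y^{r-1}<\infty$; (3) if $r\le -1$, then $\mathbb{E}X^{r-1}<\infty$ and $\mathbb{E}Y^{r-1}<\infty$. Let $$U=\frac{Y}{1+X},\qquad V=X(1+U).$$ Suppose that for some real constants $\alpha_r$ and $\alpha_{r+1}$, for each $s\in\{r,r+1\}$, almost surely $$\mathbb{E}(V^{s}\mid U)=\alpha_s\,\mathbb{E}(V^{s-1}\mid U).$$ Then $\alpha_{r+1}>\alpha_r$, $\dfrac{\alpha_{r+1}}{\alpha_{r+1}-\alpha_r}>r$, and there exists a constant $c>0$ such that $$X\sim\mathcal{K}\left(\frac{\alpha_{r+1}}{\alpha_{r+1}-\alpha_r}-r,\;c-\frac{\alpha_{r+1}}{\alpha_{r+1}-\alpha_r}+r,\;\frac{1}{\alpha_{r+1}-\alpha_r}\right),\qquad Y\sim\mathcal{G}\left(c,\frac{1}{\alpha_{r+1}-\alpha_r}\right).$$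
   Context: For $a>0$, $b\in\mathbb{R}$, $c>0$, the Kummer distribution $\mathcal{K}(a,b,c)$ is the probability distribution on $(0,\infty)$ with density proportional to $\dfrac{x^{a-1}e^{-cx}}{(1+x)^{a+b}}\,I_{(0,\infty)}(x)$. For $b>0$, $c>0$, the gamma distribution $\mathcal{G}(b,c)$ is the probability distribution on $(0,\infty)$ with density proportional to $y^{b-1}e^{-cy}I_{(0,\infty)}(y)$. A random variable is non-degenerate if it is not almost surely constant. Writing that a variable has one of these distributions includes that the parameters are well defined and admissible. *)

theory Defs
  imports "HOL-Probability.Probability"
begin

text \<open>The density proportional to a kernel \<open>k\<close>. If \<open>k\<close> is not Lebesgue integrable, the Bochner
  integral and hence the quotient are 0, so no probability distribution has this density.\<close>

definition normalized :: "(real \<Rightarrow> real) \<Rightarrow> real \<Rightarrow> real" where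
  "normalized k x = k x / (LINT t|lborel. k t)"

definition kummer_kernel :: "real \<Rightarrow> real \<Rightarrow> real \<Rightarrow> real \<Rightarrow> real" where
  "kummer_kernel a b c x =
     x powr (a - 1) * exp (- c * x) / (1 + x) powr (a + b) * indicator {0<..} x"

definition gamma_kernel :: "real \<Rightarrow> real \<Rightarrow> real \<Rightarrow> real" where
  "gamma_kernel b c y = y powr (b - 1) * exp (- c * y) * indicator {0<..} y"

definition kummer_distributed ::
  "'a measure \<Rightarrow> ('a \<Rightarrow> real) \<Rightarrow> real \<Rightarrow> real \<Rightarrow> real \<Rightarrow> bool" where
  "kummer_distributed M X a b c \<longleftrightarrow>
     a > 0 \<and> c > 0 \<and> distributed M lborel X (\<lambda>x. ennreal (normalized (kummer_kernel a b c) x))"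

definition gamma_distributed ::
  "'a measure \<Rightarrow> ('a \<Rightarrow> real) \<Rightarrow> real \<Rightarrow> real \<Rightarrow> bool" where
  "gamma_distributed M Y b c \<longleftrightarrow>
     b > 0 \<and> c > 0 \<and> distributed M lborel Y (\<lambda>y. ennreal (normalized (gamma_kernel b c) y))"

definition non_degenerate :: "'a measure \<Rightarrow> ('a \<Rightarrow> real) \<Rightarrow> bool" where
  "non_degenerate M X \<longleftrightarrow> \<not> (\<exists>k. AE \<omega> in M. X \<omega> = k)"

text \<open>The conditional expectation \<open>E(Z | U)\<close>, given the \<open>\<sigma>\<close>-algebra generated by \<open>U\<close>.\<close>

definition cond_exp_given ::
  "'a measure \<Rightarrow> ('a \<Rightarrow> real) \<Rightarrow> ('a \<Rightarrow> real) \<Rightarrow> 'a \<Rightarrow> real" where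
  "cond_exp_given M Z U = real_cond_exp M (vimage_algebra (space M) U borel) Z"

end

theory Submission
  imports Defs "HOL-Complex_Analysis.Conformal_Mappings"
begin

text \<open>Since \<open>V = X (1 + U)\<close>, the regression conditions say that
  \<open>E (h U (1 + U) X\<^sup>s) = \<alpha>\<^sub>s E (h U X\<^sup>s\<^sup>-\<^sup>1)\<close> for all \<open>h \<ge> 0\<close> and \<open>s \<in> {r, r + 1}\<close>.
  For \<open>h u = u\<^sup>n\<close> independence turns these into relations between \<open>E Y\<^sup>n\<close> and
  \<open>\<phi>\<^sub>s n = E (X\<^sup>s / (1 + X)\<^sup>n)\<close>, which also show inductively that all moments of \<open>Y\<close> are finite.
  Eliminating \<open>\<phi>\<close> by \<open>\<phi>\<^sub>s (n + 1) + \<phi>\<^sub>s\<^sub>-\<^sub>1 (n + 1) = \<phi>\<^sub>s\<^sub>-\<^sub>1 n\<close>, the moment ratios of \<open>Y\<close> increase by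
  \<open>\<delta> = \<alpha>\<^sub>r\<^sub>+\<^sub>1 - \<alpha>\<^sub>r\<close> at each step, as for a gamma distribution of rate \<open>1 / \<delta>\<close>, which is determined
  by its moments. With \<open>Y\<close> gamma of shape \<open>c\<close>, the substitution \<open>y = (1 + x) u\<close> turns the condition
  for \<open>s = r + 1\<close> into a first order differential equation for the Laplace transform of the measure
  \<open>x\<^sup>r (1 + x)\<^sup>c P\<^sub>X(dx)\<close>; its solutions are the Laplace transforms of gamma densities.\<close>

subsection \<open>Laplace transforms on an interval\<close>

text \<open>For either sign of \<open>x\<close> the left side equals one of the two summands on the
  right. An envelope containing \<open>\<bar>x\<bar>\<close> thus reduces to exponentials at the two
  parameters \<open>t + \<rho>\<close> and \<open>t - \<rho>\<close>.\<close>

lemma exp_add_abs_le: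
  fixes t \<rho> x :: real
  shows "exp (\<rho> * \<bar>x\<bar> + t * x) \<le> exp ((t + \<rho>) * x) + exp ((t - \<rho>) * x)"
proof (cases "x \<ge> 0")
  case True
  then have "\<rho> * \<bar>x\<bar> + t * x = (t + \<rho>) * x" by (simp add: algebra_simps)
  then show ?thesis by simp
next
  case False
  then have "\<rho> * \<bar>x\<bar> + t * x = (t - \<rho>) * x" by (simp add: algebra_simps)
  then show ?thesis by simp
qed

lemma power2_le_two_exp:
  fixes y :: real
  assumes "y \<ge> 0"
  shows "y\<^sup>2 \<le> 2 * exp y"
proof -
  have "1 + y + y\<^sup>2 / 2 \<le> exp y" by (rule exp_lower_Taylor_quadratic[OF assms])
  with assms show ?thesis by simp
qed

lemma integrable_exp_complex:
  fixes M :: "real measure"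
  assumes sets: "sets M = sets borel" and int: "integrable M (\<lambda>x. exp (Re z * x))"
  shows "integrable M (\<lambda>x. exp (z * complex_of_real x))"
proof (rule Bochner_Integration.integrable_bound[OF int])
  show "(\<lambda>x. exp (z * complex_of_real x)) \<in> borel_measurable M"
    unfolding measurable_cong_sets[OF sets refl] by measurable
qed (simp add: norm_exp_eq_Re)

text \<open>An envelope for differentiating under the integral sign. Shifting \<open>t\<close>
  slightly inside the interval gains a factor \<open>exp (\<rho> * \<bar>x\<bar>)\<close>, which
  absorbs powers of \<open>x\<close>. The first bound serves the candidate derivative, the second
  the quadratic Taylor remainder.\<close>

lemma laplace_bound:
  fixes M :: "real measure" and a b t :: real
  assumes sets: "sets M = sets borel"
    and int: "\<And>\<theta>. a < \<theta> \<Longrightarrow> \<theta> < b \<Longrightarrow> integrable M (\<lambda>x. exp (\<theta> * x))"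
    and t: "a < t" "t < b"
  shows "\<exists>\<rho>>0. \<exists>W. integrable M W \<and> (\<forall>x. \<bar>x\<bar> * exp (t * x) \<le> W x) \<and>
    (\<forall>x. x\<^sup>2 * exp (\<rho> * \<bar>x\<bar> + t * x) \<le> W x)"
proof -
  \<comment> \<open>A quarter keeps \<open>t + 2 * \<rho>\<close> and \<open>t - 2 * \<rho>\<close>
    strictly inside the interval: one \<open>\<rho>\<close> is the exponent in the second bound, the
    other absorbs \<open>x\<^sup>2\<close>.\<close>
  define \<rho> where "\<rho> = min (b - t) (t - a) / 4"
  have \<rho>: "\<rho> > 0" "a < t - 2 * \<rho>" "t + 2 * \<rho> < b"
    using t unfolding \<rho>_def by (auto simp: min_def field_simps)
  define V where "V = (\<lambda>x. exp ((t + 2 * \<rho>) * x) + exp ((t - 2 * \<rho>) * x))"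
  have V: "exp (2 * \<rho> * \<bar>x\<bar> + t * x) \<le> V x" for x
    unfolding V_def using exp_add_abs_le[of "2 * \<rho>" x t] by simp
  define W where "W = (\<lambda>x. (1 / \<rho> + 2 / \<rho>\<^sup>2) * V x)"
  have "integrable M W"
    unfolding W_def V_def
    by (rule integrable_mult_right, rule Bochner_Integration.integrable_add; rule int) (use \<rho> in auto)
  moreover have "\<bar>x\<bar> * exp (t * x) \<le> W x" for x
  proof -
    have "\<rho> * \<bar>x\<bar> \<le> exp (\<rho> * \<bar>x\<bar>)"
      using exp_ge_add_one_self[of "\<rho> * \<bar>x\<bar>"] by linarith
    also have "\<dots> \<le> exp (2 * \<rho> * \<bar>x\<bar>)" using \<rho> by simp
    finally have "\<bar>x\<bar> \<le> 1 / \<rho> * exp (2 * \<rho> * \<bar>x\<bar>)" using \<rho> by (simp add: field_simps)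
    then have "\<bar>x\<bar> * exp (t * x) \<le> 1 / \<rho> * exp (2 * \<rho> * \<bar>x\<bar>) * exp (t * x)"
      by (intro mult_right_mono) auto
    also have "\<dots> = 1 / \<rho> * exp (2 * \<rho> * \<bar>x\<bar> + t * x)" by (simp add: exp_add)
    also have "\<dots> \<le> (1 / \<rho> + 2 / \<rho>\<^sup>2) * exp (2 * \<rho> * \<bar>x\<bar> + t * x)"
      by (intro mult_right_mono) auto
    also have "\<dots> \<le> W x" unfolding W_def using \<rho> V by (intro mult_left_mono) auto
    finally show ?thesis .
  qed
  moreover have "x\<^sup>2 * exp (\<rho> * \<bar>x\<bar> + t * x) \<le> W x" for x
  proof -
    have "(\<rho> * \<bar>x\<bar>)\<^sup>2 \<le> 2 * exp (\<rho> * \<bar>x\<bar>)" using \<rho> by (intro power2_le_two_exp) auto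
    then have "x\<^sup>2 \<le> 2 / \<rho>\<^sup>2 * exp (\<rho> * \<bar>x\<bar>)"
      using \<rho> by (simp add: field_simps power_mult_distrib)
    then have "x\<^sup>2 * exp (\<rho> * \<bar>x\<bar> + t * x) \<le> 2 / \<rho>\<^sup>2 * exp (\<rho> * \<bar>x\<bar>) * exp (\<rho> * \<bar>x\<bar> + t * x)"
      by (intro mult_right_mono) auto
    also have "\<dots> = 2 / \<rho>\<^sup>2 * exp (2 * \<rho> * \<bar>x\<bar> + t * x)"
      by (simp add: exp_add[symmetric] algebra_simps)
    also have "\<dots> \<le> (1 / \<rho> + 2 / \<rho>\<^sup>2) * exp (2 * \<rho> * \<bar>x\<bar> + t * x)"
      using \<rho> by (intro mult_right_mono) auto
    also have "\<dots> \<le> W x" unfolding W_def using \<rho> V by (intro mult_left_mono) auto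
    finally show ?thesis .
  qed
  ultimately show ?thesis using \<rho>(1) by blast
qed

lemma integrable_mult_exp_complex:
  fixes M :: "real measure" and a b :: real and z :: complex
  assumes sets: "sets M = sets borel"
    and int: "\<And>\<theta>. a < \<theta> \<Longrightarrow> \<theta> < b \<Longrightarrow> integrable M (\<lambda>x. exp (\<theta> * x))"
    and z: "a < Re z" "Re z < b"
  shows "integrable M (\<lambda>x. complex_of_real x * exp (z * complex_of_real x))"
proof -
  obtain \<rho> W where W: "\<rho> > 0" "integrable M W" "\<And>x. \<bar>x\<bar> * exp (Re z * x) \<le> W x"
      "\<And>x. x\<^sup>2 * exp (\<rho> * \<bar>x\<bar> + Re z * x) \<le> W x"
    using laplace_bound[OF sets int z] by blast
  show ?thesis
  proof (rule Bochner_Integration.integrable_bound[OF W(2)])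
    show "(\<lambda>x. complex_of_real x * exp (z * complex_of_real x)) \<in> borel_measurable M"
      unfolding measurable_cong_sets[OF sets refl] by measurable
    show "AE x in M. norm (complex_of_real x * exp (z * complex_of_real x)) \<le> norm (W x)"
    proof (rule AE_I2)
      fix x
      have "norm (complex_of_real x * exp (z * complex_of_real x)) \<le> W x"
        using W(3)[of x] by (simp add: norm_mult norm_exp_eq_Re)
      then show "norm (complex_of_real x * exp (z * complex_of_real x)) \<le> norm (W x)" by simp
    qed
  qed
qed

text \<open>The difference quotient differs from its limit by the integral of exp (z x) (exp v - 1 -
  v) / w with v = w x. The remainder is at most |v|^2 exp |v|, so the envelope of
  \<open>laplace_bound\<close> gives an error of order |w|.\<close>

lemma has_field_derivative_laplace:
  fixes M :: "real measure" and a b :: real and z :: complex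
  assumes sets: "sets M = sets borel"
    and int: "\<And>\<theta>. a < \<theta> \<Longrightarrow> \<theta> < b \<Longrightarrow> integrable M (\<lambda>x. exp (\<theta> * x))"
    and z: "a < Re z" "Re z < b"
  shows "((\<lambda>z. CLINT x|M. exp (z * complex_of_real x)) has_field_derivative
           (CLINT x|M. complex_of_real x * exp (z * complex_of_real x))) (at z)"
proof -
  obtain \<rho> W where \<rho>: "\<rho> > 0" and W: "integrable M W" "\<And>x. \<bar>x\<bar> * exp (Re z * x) \<le> W x"
    "\<And>x. x\<^sup>2 * exp (\<rho> * \<bar>x\<bar> + Re z * x) \<le> W x"
    using laplace_bound[OF sets int z] by blast
  define F where "F = (\<lambda>z. CLINT x|M. exp (z * complex_of_real x))"
  define D where "D = (CLINT x|M. complex_of_real x * exp (z * complex_of_real x))"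
  \<comment> \<open>The bound by \<open>\<rho>\<close> lets the envelope absorb exp |w x|; the other
    two keep \<open>z + w\<close> inside the strip.\<close>
  define \<epsilon> where "\<epsilon> = min \<rho> (min (b - Re z) (Re z - a))"
  have \<epsilon>: "\<epsilon> > 0" using z \<rho> unfolding \<epsilon>_def by auto
  have point: "norm (exp ((z + w) * complex_of_real x) - exp (z * complex_of_real x)
        - w * (complex_of_real x * exp (z * complex_of_real x))) \<le> (norm w)\<^sup>2 * W x"
    if "norm w < \<epsilon>" for w x
  proof -
    let ?v = "w * complex_of_real x"
    have nv: "norm ?v \<le> \<rho> * \<bar>x\<bar>"
      using that unfolding \<epsilon>_def by (auto simp: norm_mult intro!: mult_right_mono)
    have "norm (exp ?v - 1 - ?v) \<le> exp (norm ?v) * (norm ?v)\<^sup>2"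
      using Taylor_exp_field[of ?v 1] by (simp add: power2_eq_square algebra_simps)
    also have "\<dots> \<le> exp (\<rho> * \<bar>x\<bar>) * (norm ?v)\<^sup>2"
      using nv by (intro mult_right_mono) auto
    finally have *: "norm (exp ?v - 1 - ?v) \<le> (norm w)\<^sup>2 * (x\<^sup>2 * exp (\<rho> * \<bar>x\<bar>))"
      by (simp add: norm_mult power_mult_distrib algebra_simps)
    have "exp ((z + w) * complex_of_real x) - exp (z * complex_of_real x)
        - w * (complex_of_real x * exp (z * complex_of_real x))
        = exp (z * complex_of_real x) * (exp ?v - 1 - ?v)"
      by (simp add: algebra_simps exp_add)
    also have "norm \<dots> = exp (Re z * x) * norm (exp ?v - 1 - ?v)"
      by (simp add: norm_mult norm_exp_eq_Re)
    also have "\<dots> \<le> exp (Re z * x) * ((norm w)\<^sup>2 * (x\<^sup>2 * exp (\<rho> * \<bar>x\<bar>)))"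
      using * by (intro mult_left_mono) auto
    also have "\<dots> = (norm w)\<^sup>2 * (x\<^sup>2 * exp (\<rho> * \<bar>x\<bar> + Re z * x))"
      by (simp add: exp_add algebra_simps)
    also have "\<dots> \<le> (norm w)\<^sup>2 * W x" using W(3) by (intro mult_left_mono) auto
    finally show ?thesis .
  qed
  have bound: "norm ((F (z + w) - F z) / w - D) \<le> norm w * (LINT x|M. W x)"
    if w: "norm w < \<epsilon>" "w \<noteq> 0" for w
  proof -
    have rw: "a < Re (z + w)" "Re (z + w) < b"
      using w abs_Re_le_cmod[of w] unfolding \<epsilon>_def by auto
    note I = integrable_exp_complex[OF sets int[OF rw]] integrable_exp_complex[OF sets int[OF z]]
      integrable_mult_right[OF integrable_mult_exp_complex[OF sets int z], where c = w]
    have "F (z + w) - F z - w * D = (CLINT x|M. exp ((z + w) * complex_of_real x)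
        - exp (z * complex_of_real x) - w * (complex_of_real x * exp (z * complex_of_real x)))"
      unfolding F_def D_def using I by simp
    also have "norm \<dots> \<le> (LINT x|M. (norm w)\<^sup>2 * W x)"
      using I W(1) point[OF w(1)]
      by (intro order.trans[OF integral_norm_bound] integral_mono integrable_norm) auto
    finally have "norm (F (z + w) - F z - w * D) \<le> (norm w)\<^sup>2 * (LINT x|M. W x)" by simp
    moreover have "(F (z + w) - F z) / w - D = (F (z + w) - F z - w * D) / w"
      using w by (simp add: field_simps)
    ultimately show ?thesis
      using w by (simp add: norm_divide divide_simps power2_eq_square mult_ac)
  qed
  have "((\<lambda>w. (F (z + w) - F z) / w - D) \<longlongrightarrow> 0) (at 0)"
  proof (rule Lim_null_comparison)
    show "\<forall>\<^sub>F w in at 0. norm ((F (z + w) - F z) / w - D) \<le> norm w * (LINT x|M. W x)"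
      unfolding eventually_at using \<epsilon> bound by (intro exI[of _ \<epsilon>]) auto
    show "((\<lambda>w. norm w * (LINT x|M. W x)) \<longlongrightarrow> 0) (at 0)"
      by (rule tendsto_eq_intros refl)+ simp
  qed
  then have "((\<lambda>w. (F (z + w) - F z) / w) \<longlongrightarrow> D) (at 0)"
    by (rule LIM_zero_cancel)
  then show ?thesis unfolding F_def D_def DERIV_def .
qed

text \<open>Both transforms are holomorphic on the vertical strip and agree on its real segment,
  which has an accumulation point in the strip, so the identity theorem applies.\<close>

lemma laplace_eq_on_strip:
  fixes M N :: "real measure" and a b :: real and z :: complex
  assumes M: "sets M = sets borel" and N: "sets N = sets borel"
    and intM: "\<And>\<theta>. a < \<theta> \<Longrightarrow> \<theta> < b \<Longrightarrow> integrable M (\<lambda>x. exp (\<theta> * x))"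
    and intN: "\<And>\<theta>. a < \<theta> \<Longrightarrow> \<theta> < b \<Longrightarrow> integrable N (\<lambda>x. exp (\<theta> * x))"
    and eq: "\<And>\<theta>. a < \<theta> \<Longrightarrow> \<theta> < b \<Longrightarrow> (LINT x|M. exp (\<theta> * x)) = (LINT x|N. exp (\<theta> * x))"
    and z: "a < Re z" "Re z < b"
  shows "(CLINT x|M. exp (z * complex_of_real x)) = (CLINT x|N. exp (z * complex_of_real x))"
proof -
  define F where "F = (\<lambda>M z. CLINT x|M. exp (z * complex_of_real x))"
  define S where "S = {z. a < Re z} \<inter> {z. Re z < b}"
  define R where "R = complex_of_real ` {a<..<b}"
  \<comment> \<open>The midpoint of the real segment serves as the accumulation point.\<close>
  define \<xi> where "\<xi> = complex_of_real ((a + b) / 2)"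
  have hol: "(\<lambda>z. F M z - F N z) holomorphic_on S"
    unfolding holomorphic_on_def field_differentiable_def
  proof
    fix w assume "w \<in> S"
    then have w: "a < Re w" "Re w < b" unfolding S_def by auto
    show "\<exists>f'. ((\<lambda>z. F M z - F N z) has_field_derivative f') (at w within S)"
      unfolding F_def
      using DERIV_diff[OF has_field_derivative_laplace[OF M intM w] has_field_derivative_laplace[OF N intN w]]
      by (blast intro: has_field_derivative_at_within)
  qed
  have S: "open S" "connected S"
    unfolding S_def
    by (rule open_Int[OF open_halfspace_Re_gt open_halfspace_Re_lt],
        rule convex_connected[OF convex_Int[OF convex_halfspace_Re_gt convex_halfspace_Re_lt]])
  have R0: "F M w - F N w = 0" if w: "w \<in> R" for w
  proof -
    obtain \<theta> where \<theta>: "w = complex_of_real \<theta>" "a < \<theta>" "\<theta> < b" using w unfolding R_def by auto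
    have "F L w = complex_of_real (LINT x|L. exp (\<theta> * x))" for L
      unfolding F_def \<theta>(1) of_real_mult[symmetric] exp_of_real by simp
    with eq[OF \<theta>(2,3)] show ?thesis by simp
  qed
  have lim: "\<xi> islimpt R"
  proof -
    have "\<exists>w\<in>R. w \<noteq> \<xi> \<and> dist w \<xi> < e" if "e > 0" for e
    proof -
      define d where "d = min (e / 2) ((b - a) / 4)"
      have d: "0 < d" "d < e" "d < (b - a) / 2"
        using that z unfolding d_def by (auto simp: min_def field_simps)
      have "complex_of_real ((a + b) / 2 + d) \<in> R"
        unfolding R_def using d z by (intro imageI) (auto simp: field_simps)
      moreover have "complex_of_real ((a + b) / 2 + d) - \<xi> = complex_of_real d"
        unfolding \<xi>_def of_real_diff[symmetric] by simp
      ultimately show ?thesis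
        using d by (intro bexI[of _ "complex_of_real ((a + b) / 2 + d)"]) (auto simp: dist_norm)
    qed
    then show ?thesis unfolding islimpt_approachable by blast
  qed
  have mem: "R \<subseteq> S" "\<xi> \<in> S" "z \<in> S" using z unfolding \<xi>_def S_def R_def by auto
  have "F M z - F N z = 0"
    by (rule analytic_continuation[OF hol S mem(1,2) lim R0 mem(3)])
  then show ?thesis unfolding F_def by simp
qed

text \<open>Exponential tilting at an interior point \<open>t\<close> turns both measures into
  probability measures whose characteristic functions are the transforms on the line Re z = t,
  divided by \<open>m\<close>. Levy's uniqueness theorem identifies the tilted measures, and the
  tilt is invertible. This also covers measures of infinite total mass.\<close>

lemma measure_eqI_laplace:
  fixes M N :: "real measure" and a b :: real
  assumes M: "sets M = sets borel" and N: "sets N = sets borel" and ab: "a < b"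
    and fin: "\<And>\<theta>. a < \<theta> \<Longrightarrow> \<theta> < b \<Longrightarrow> (\<integral>\<^sup>+x. ennreal (exp (\<theta> * x)) \<partial>N) < \<infinity>"
    and eq: "\<And>\<theta>. a < \<theta> \<Longrightarrow> \<theta> < b \<Longrightarrow>
      (\<integral>\<^sup>+x. ennreal (exp (\<theta> * x)) \<partial>M) = (\<integral>\<^sup>+x. ennreal (exp (\<theta> * x)) \<partial>N)"
  shows "M = N"
proof -
  have meas: "f \<in> borel_measurable M" "f \<in> borel_measurable N"
    if "f \<in> borel_measurable borel" for f :: "real \<Rightarrow> 'a::topological_space"
    using that by (simp_all add: measurable_cong_sets[OF M refl] measurable_cong_sets[OF N refl])
  have intM: "integrable M (\<lambda>x. exp (\<theta> * x))" and intN: "integrable N (\<lambda>x. exp (\<theta> * x))"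
    if "a < \<theta>" "\<theta> < b" for \<theta>
    using fin[OF that] eq[OF that] by (auto simp: integrable_iff_bounded intro!: meas)
  have eq': "(LINT x|M. exp (\<theta> * x)) = (LINT x|N. exp (\<theta> * x))" if "a < \<theta>" "\<theta> < b" for \<theta>
    using eq[OF that] by (simp add: integral_eq_nn_integral meas)
  define t where "t = (a + b) / 2"
  have t: "a < t" "t < b" using ab by (auto simp: t_def)
  define m where "m = (LINT x|N. exp (t * x))"
  have m: "ennreal m = (\<integral>\<^sup>+x. ennreal (exp (t * x)) \<partial>N)"
    unfolding m_def using intN[OF t] by (simp add: nn_integral_eq_integral)
  have m0: "m \<ge> 0" unfolding m_def by simp
  show ?thesis
  proof (cases "m = 0")
    \<comment> \<open>Tilting cannot be normalized here, but the exponential is positive everywhere,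
      so both measures vanish.\<close>
    case True
    have "emeasure L A = 0"
      if "sets L = sets borel" "(\<integral>\<^sup>+x. ennreal (exp (t * x)) \<partial>L) = 0" "A \<in> sets borel" for L A
    proof -
      have "AE x in L. ennreal (exp (t * x)) = 0"
        using that by (subst nn_integral_0_iff_AE[symmetric])
          (auto simp: measurable_cong_sets[OF that(1) refl])
      then have "AE x in L. x \<notin> A" by eventually_elim simp
      then show ?thesis using that by (auto simp: AE_iff_null_sets[symmetric])
    qed
    then show ?thesis using True m eq[OF t] M N by (intro measure_eqI) auto
  next
    case False
    then have mp: "m > 0" using m0 by simp
    define T where "T = (\<lambda>L. density L (\<lambda>x. ennreal (exp (t * x) / m)))"
    have T_prob: "real_distribution (T L)"
      if L: "sets L = sets borel" "(\<integral>\<^sup>+x. ennreal (exp (t * x)) \<partial>L) = ennreal m" for L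
    proof -
      note [measurable_cong] = L(1)
      have "emeasure (T L) (space (T L)) = (\<integral>\<^sup>+x. ennreal (exp (t * x) / m) \<partial>L)"
        unfolding T_def by (simp add: emeasure_density cong: nn_integral_cong_simp)
      also have "\<dots> = (\<integral>\<^sup>+x. ennreal (1 / m) * ennreal (exp (t * x)) \<partial>L)"
        using mp by (intro nn_integral_cong) (simp add: ennreal_mult'[symmetric])
      also have "\<dots> = ennreal (1 / m) * ennreal m"
        by (simp add: nn_integral_cmult L(2))
      also have "\<dots> = 1" using mp by (simp add: ennreal_mult[symmetric])
      finally show ?thesis
        unfolding real_distribution_def real_distribution_axioms_def
        using L by (auto intro!: prob_spaceI simp: T_def)
    qed
    have char: "char (T L) s = (CLINT x|L. exp ((complex_of_real t + \<i> * s) * complex_of_real x)) / m"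
      if L: "sets L = sets borel" for L s
    proof -
      note [measurable_cong] = L(1)
      have "char (T L) s = (CLINT x|L. (exp (t * x) / m) *\<^sub>R iexp (s * x))"
        unfolding char_def T_def using mp by (subst integral_density) auto
      also have "\<dots> = (CLINT x|L. exp ((complex_of_real t + \<i> * s) * complex_of_real x) / m)"
        by (intro Bochner_Integration.integral_cong refl)
          (simp add: scaleR_conv_of_real exp_add exp_of_real[symmetric] algebra_simps)
      finally show ?thesis by simp
    qed
    have "T M = T N"
    proof (rule Levy_uniqueness)
      show "real_distribution (T M)" "real_distribution (T N)"
        using T_prob[OF M] T_prob[OF N] m eq[OF t] by auto
      show "char (T M) = char (T N)"
        using laplace_eq_on_strip[OF M N intM intN eq', where z = "complex_of_real t + \<i> * complex_of_real _"] t
        by (intro ext) (simp add: char M N)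
    qed
    \<comment> \<open>The reciprocal density undoes the tilt.\<close>
    moreover have "density (T L) (\<lambda>x. ennreal (m * exp (- t * x))) = L" if L: "sets L = sets borel" for L
    proof -
      note [measurable_cong] = L(1)
      have "density (T L) (\<lambda>x. ennreal (m * exp (- t * x))) = density L (\<lambda>x. 1)"
        unfolding T_def using mp by (subst density_density_eq)
          (auto simp: ennreal_mult[symmetric] exp_minus intro!: density_cong)
      then show ?thesis by (simp add: density_1)
    qed
    ultimately show ?thesis using M N by metis
  qed
qed

subsection \<open>Gamma kernels\<close>

lemma gamma_kernel_nonneg [simp]: "gamma_kernel b c y \<ge> 0"
  unfolding gamma_kernel_def by simp

lemma kummer_kernel_nonneg [simp]: "kummer_kernel a b c x \<ge> 0"
  unfolding kummer_kernel_def by simp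

lemma borel_measurable_gamma_kernel [measurable]: "gamma_kernel b c \<in> borel_measurable borel"
  unfolding gamma_kernel_def by measurable

lemma borel_measurable_kummer_kernel [measurable]: "kummer_kernel a b c \<in> borel_measurable borel"
  unfolding kummer_kernel_def by measurable

lemma normalized_eqI:
  assumes "k \<in> borel_measurable borel" "\<And>x. k x \<ge> 0"
    and "(\<integral>\<^sup>+x. ennreal (k x) \<partial>lborel) = ennreal I" "I \<ge> 0"
  shows "normalized k x = k x / I"
  using assms by (simp add: normalized_def integral_eq_nn_integral)

text \<open>The substitution y = x / c reduces this to Euler's integral for the Gamma
  function.\<close>

lemma nn_integral_gamma_kernel:
  assumes b: "b > 0" and c: "c > 0"
  shows "(\<integral>\<^sup>+y. ennreal (gamma_kernel b c y) \<partial>lborel) = ennreal (Gamma b / c powr b)"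
proof -
  have "(\<integral>\<^sup>+y. ennreal (gamma_kernel b c y) \<partial>lborel)
      = ennreal (1 / c) * (\<integral>\<^sup>+x. ennreal (gamma_kernel b c (x / c)) \<partial>lborel)"
    using nn_integral_real_affine[of "\<lambda>y. ennreal (gamma_kernel b c y)" "1 / c" 0] c by simp
  also have "(\<integral>\<^sup>+x. ennreal (gamma_kernel b c (x / c)) \<partial>lborel)
      = (\<integral>\<^sup>+x. ennreal (c powr (1 - b)) * ennreal (indicator {0..} x * x powr (b - 1) / exp x) \<partial>lborel)"
  proof (rule nn_integral_cong)
    fix x :: real
    have "gamma_kernel b c (x / c) = c powr (1 - b) * (indicator {0..} x * x powr (b - 1) / exp x)"
    proof (cases "x > 0")
      case True
      then have "gamma_kernel b c (x / c) = x powr (b - 1) / c powr (b - 1) * exp (- x)"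
        using c by (simp add: gamma_kernel_def powr_divide)
      moreover have "c powr (1 - b) = 1 / c powr (b - 1)"
        using powr_minus_divide[of c "b - 1"] by simp
      ultimately show ?thesis using True by (simp add: exp_minus field_simps)
    next
      case False
      then show ?thesis using c by (cases "x = 0") (auto simp: gamma_kernel_def field_simps)
    qed
    then show "ennreal (gamma_kernel b c (x / c))
        = ennreal (c powr (1 - b)) * ennreal (indicator {0..} x * x powr (b - 1) / exp x)"
      by (simp add: ennreal_mult'[symmetric])
  qed
  also have "\<dots> = ennreal (c powr (1 - b)) * ennreal (Gamma b)"
    by (simp add: nn_integral_cmult Gamma_conv_nn_integral_real[OF b])
  also have "ennreal (1 / c) * \<dots> = ennreal (1 / c * (c powr (1 - b) * Gamma b))"
    using b c by (simp add: ennreal_mult'[symmetric] Gamma_real_pos less_imp_le)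
  also have "1 / c * (c powr (1 - b) * Gamma b) = Gamma b / c powr b"
    using c by (simp add: powr_diff field_simps)
  finally show ?thesis .
qed

lemma exp_mult_gamma_kernel: "exp (\<theta> * y) * gamma_kernel b c y = gamma_kernel b (c - \<theta>) y"
proof -
  have "exp (\<theta> * y) * exp (- c * y) = exp (- (c - \<theta>) * y)"
    by (simp add: exp_add[symmetric] algebra_simps)
  then show ?thesis by (simp add: gamma_kernel_def mult_ac)
qed

lemma power_mult_gamma_kernel: "y ^ n * gamma_kernel b c y = gamma_kernel (b + real n) c y"
proof (cases "y > 0")
  case True
  then have "y ^ n * y powr (b - 1) = y powr (b + real n - 1)"
    by (simp add: powr_realpow[symmetric] powr_add[symmetric] algebra_simps)
  then show ?thesis by (simp add: gamma_kernel_def mult_ac)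
qed (simp add: gamma_kernel_def)

text \<open>For positive \<open>y\<close> and \<open>\<theta>\<close> all terms of the exponential
  series are nonnegative, so sum and integral may be exchanged even if some of them are infinite. On
  positive \<open>\<theta>\<close> the transform is thus a function of the moments alone.\<close>

lemma nn_integral_exp_moments:
  fixes L :: "real measure"
  assumes sets: "sets L = sets borel" and pos: "AE y in L. y > 0" and \<theta>: "\<theta> > 0"
  shows "(\<integral>\<^sup>+y. ennreal (exp (\<theta> * y)) \<partial>L)
    = (\<Sum>n. ennreal (\<theta> ^ n / fact n) * (\<integral>\<^sup>+y. ennreal (y ^ n) \<partial>L))"
proof -
  note [measurable_cong] = sets
  have "(\<integral>\<^sup>+y. ennreal (exp (\<theta> * y)) \<partial>L)
      = (\<integral>\<^sup>+y. (\<Sum>n. ennreal (\<theta> ^ n / fact n) * ennreal (y ^ n)) \<partial>L)"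
  proof (rule nn_integral_cong_AE, use pos in eventually_elim)
    case (elim y)
    have "(\<lambda>n. (\<theta> * y) ^ n /\<^sub>R fact n) sums exp (\<theta> * y)" by (rule exp_converges)
    then have "(\<lambda>n. \<theta> ^ n / fact n * y ^ n) sums exp (\<theta> * y)"
      by (simp add: power_mult_distrib field_simps)
    then have "ennreal (exp (\<theta> * y)) = (\<Sum>n. ennreal (\<theta> ^ n / fact n * y ^ n))"
      using \<theta> elim by (simp add: suminf_ennreal2 sums_iff)
    also have "\<dots> = (\<Sum>n. ennreal (\<theta> ^ n / fact n) * ennreal (y ^ n))"
      using \<theta> elim by (subst ennreal_mult) auto
    finally show ?case .
  qed
  also have "\<dots> = (\<Sum>n. ennreal (\<theta> ^ n / fact n) * (\<integral>\<^sup>+y. ennreal (y ^ n) \<partial>L))"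
    by (simp add: nn_integral_suminf nn_integral_cmult)
  finally show ?thesis .
qed

text \<open>Total mass 1 and the recurrence determine every moment. The moment series then gives the
  exponential moments, which for a gamma law are finite on (0, c), and there they determine the
  measure.\<close>

lemma gamma_distribution_unique:
  fixes \<nu> :: "real measure"
  assumes prob: "prob_space \<nu>" and sets: "sets \<nu> = sets borel" and pos: "AE y in \<nu>. y > 0"
    and b: "b > 0" and c: "c > 0"
    and moments: "\<And>n. (\<integral>\<^sup>+y. ennreal (y ^ Suc n) \<partial>\<nu>)
        = ennreal ((b + real n) / c) * (\<integral>\<^sup>+y. ennreal (y ^ n) \<partial>\<nu>)"
  shows "\<nu> = density lborel (\<lambda>y. ennreal (normalized (gamma_kernel b c) y))"
proof -
  define I where "I = Gamma b / c powr b"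
  have I: "I > 0" unfolding I_def using b c by (simp add: Gamma_real_pos)
  have norm: "normalized (gamma_kernel b c) y = gamma_kernel b c y / I" for y
    using I unfolding I_def
    by (intro normalized_eqI nn_integral_gamma_kernel[OF b c]) auto
  define N where "N = density lborel (\<lambda>y. ennreal (gamma_kernel b c y / I))"
  have N_int: "(\<integral>\<^sup>+y. ennreal (f y) \<partial>N) = (\<integral>\<^sup>+y. ennreal (f y * gamma_kernel b c y) \<partial>lborel) / ennreal I"
    if [measurable]: "f \<in> borel_measurable borel" for f
  proof -
    have "(\<integral>\<^sup>+y. ennreal (f y) \<partial>N)
        = (\<integral>\<^sup>+y. ennreal (gamma_kernel b c y / I) * ennreal (f y) \<partial>lborel)"
      unfolding N_def by (simp add: nn_integral_density)
    also have "\<dots> = (\<integral>\<^sup>+y. ennreal (f y * gamma_kernel b c y) / ennreal I \<partial>lborel)"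
    proof (rule nn_integral_cong)
      fix y
      show "ennreal (gamma_kernel b c y / I) * ennreal (f y) = ennreal (f y * gamma_kernel b c y) / ennreal I"
      proof (cases "f y \<ge> 0")
        case True
        then show ?thesis using I by (simp add: divide_ennreal ennreal_mult[symmetric] mult_ac)
      next
        case False
        then have "f y * gamma_kernel b c y \<le> 0" by (simp add: mult_nonpos_nonneg)
        then show ?thesis using False by (simp add: ennreal_neg)
      qed
    qed
    also have "\<dots> = (\<integral>\<^sup>+y. ennreal (f y * gamma_kernel b c y) \<partial>lborel) / ennreal I"
      by (simp add: nn_integral_divide)
    finally show ?thesis .
  qed
  have N_sets: "sets N = sets borel" unfolding N_def by simp
  have N_pos: "AE y in N. y > 0"
    unfolding N_def by (subst AE_density) (auto simp: gamma_kernel_def indicator_def)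
  have N_moment: "(\<integral>\<^sup>+y. ennreal (y ^ n) \<partial>N) = ennreal (Gamma (b + real n) / c powr (b + real n) / I)" for n
    using I b c by (simp add: N_int power_mult_gamma_kernel nn_integral_gamma_kernel divide_ennreal Gamma_real_pos less_imp_le)
  have same: "(\<integral>\<^sup>+y. ennreal (y ^ n) \<partial>\<nu>) = (\<integral>\<^sup>+y. ennreal (y ^ n) \<partial>N)" for n
  proof (induction n)
    case 0
    have "(\<integral>\<^sup>+y. ennreal (y ^ 0) \<partial>\<nu>) = 1" using prob by (simp add: prob_space.emeasure_space_1)
    moreover have "(\<integral>\<^sup>+y. ennreal (y ^ 0) \<partial>N) = 1"
      unfolding N_moment using I by (simp flip: I_def)
    ultimately show ?case by simp
  next
    case (Suc n)
    have "b + real n \<notin> \<int>\<^sub>\<le>\<^sub>0" using b by (auto elim!: nonpos_Ints_cases)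
    then have "Gamma (b + real (Suc n)) = (b + real n) * Gamma (b + real n)"
      using Gamma_plus1[of "b + real n"] by (simp add: add_ac)
    then have "(b + real n) / c * (Gamma (b + real n) / c powr (b + real n) / I)
        = Gamma (b + real (Suc n)) / c powr (b + real (Suc n)) / I"
      using c by (simp add: powr_add field_simps)
    moreover have "(b + real n) / c \<ge> 0" using b c by simp
    ultimately show ?case
      unfolding moments Suc.IH N_moment by (simp add: ennreal_mult'[symmetric])
  qed
  have "\<nu> = N"
  \<comment> \<open>The interval (0, c) lies where the moment series has nonnegative terms and where
    the gamma transform is finite; finiteness for \<open>\<nu>\<close> comes from the
    equality.\<close>
  proof (rule measure_eqI_laplace[OF sets N_sets c])
    fix \<theta> :: real assume \<theta>: "0 < \<theta>" "\<theta> < c"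
    show "(\<integral>\<^sup>+y. ennreal (exp (\<theta> * y)) \<partial>\<nu>) = (\<integral>\<^sup>+y. ennreal (exp (\<theta> * y)) \<partial>N)"
      unfolding nn_integral_exp_moments[OF sets pos \<theta>(1)]
        nn_integral_exp_moments[OF N_sets N_pos \<theta>(1)] same ..
    show "(\<integral>\<^sup>+y. ennreal (exp (\<theta> * y)) \<partial>N) < \<infinity>"
      using \<theta> b I by (simp add: N_int exp_mult_gamma_kernel nn_integral_gamma_kernel divide_ennreal
          Gamma_real_pos less_imp_le)
  qed
  then show ?thesis unfolding N_def norm .
qed

subsection \<open>Laplace transforms of Kummer type\<close>

lemma has_real_derivative_laplace:
  fixes M :: "real measure" and a b t :: real
  assumes sets: "sets M = sets borel"
    and int: "\<And>\<theta>. a < \<theta> \<Longrightarrow> \<theta> < b \<Longrightarrow> integrable M (\<lambda>x. exp (\<theta> * x))"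
    and t: "a < t" "t < b"
  shows "((\<lambda>t. LINT x|M. exp (t * x)) has_real_derivative (LINT x|M. x * exp (t * x))) (at t)"
proof -
  have "((\<lambda>s. CLINT x|M. exp (complex_of_real s * complex_of_real x)) has_vector_derivative
      (CLINT x|M. complex_of_real x * exp (complex_of_real t * complex_of_real x))) (at t)"
    using has_field_derivative_laplace[OF sets int, where z = "complex_of_real t"] t
    by (intro has_vector_derivative_real_field) auto
  then have "((\<lambda>s. complex_of_real (LINT x|M. exp (s * x))) has_vector_derivative
      complex_of_real (LINT x|M. x * exp (t * x))) (at t)"
    unfolding of_real_mult[symmetric] exp_of_real integral_complex_of_real .
  from bounded_linear.has_vector_derivative[OF bounded_linear_Re this] show ?thesis
    by (simp add: has_real_derivative_iff_has_vector_derivative)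
qed

text \<open>The derivative is itself the Laplace transform of the measure with density
  \<open>x\<close> with respect to \<open>M\<close>, hence differentiable.\<close>

lemma isCont_laplace_deriv:
  fixes M :: "real measure" and a b t :: real
  assumes sets: "sets M = sets borel" and pos: "AE x in M. x > 0"
    and int: "\<And>\<theta>. a < \<theta> \<Longrightarrow> \<theta> < b \<Longrightarrow> integrable M (\<lambda>x. exp (\<theta> * x))"
    and t: "a < t" "t < b"
  shows "isCont (\<lambda>t. LINT x|M. x * exp (t * x)) t"
proof -
  note [measurable_cong] = sets
  define N where "N = density M (\<lambda>x. ennreal x)"
  have N: "sets N = sets borel" unfolding N_def using sets by simp
  have eq: "(LINT x|N. exp (\<theta> * x)) = (LINT x|M. x * exp (\<theta> * x))" for \<theta>
    unfolding N_def using pos by (subst integral_density) auto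
  have "integrable N (\<lambda>x. exp (\<theta> * x))" if "a < \<theta>" "\<theta> < b" for \<theta>
  proof -
    have "complex_integrable M (\<lambda>x. complex_of_real x * exp (complex_of_real \<theta> * complex_of_real x))"
      using integrable_mult_exp_complex[OF sets int, where z = "complex_of_real \<theta>"] that by simp
    then have "integrable M (\<lambda>x. x * exp (\<theta> * x))"
      unfolding of_real_mult[symmetric] exp_of_real complex_of_real_integrable_eq .
    then show ?thesis
      unfolding N_def using pos by (subst integrable_density) auto
  qed
  from has_real_derivative_laplace[OF N this t] show ?thesis
    unfolding eq by (auto intro: DERIV_isCont)
qed

text \<open>The points of the half-line where a continuous function is nonzero form an open set, and
  a nonempty open set is not negligible.\<close>

lemma AE_lborel_eq_imp_eq:
  fixes f :: "real \<Rightarrow> real"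
  assumes ae: "AE u in lborel. u > 0 \<longrightarrow> f u = 0" and cont: "continuous_on {0<..} f" and u: "u > 0"
  shows "f u = 0"
proof (rule ccontr)
  assume "f u \<noteq> 0"
  define S where "S = {x \<in> {0<..}. f x \<in> - {0}}"
  have "open S" unfolding S_def
    using cont by (intro continuous_open_preimage[unfolded vimage_def Int_def mem_Collect_eq, simplified]) auto
  moreover have "u \<in> S" using \<open>f u \<noteq> 0\<close> u unfolding S_def by simp
  ultimately have "\<not> negligible S" using open_not_negligible by blast
  moreover have "AE u in lebesgue. u \<notin> S"
    using AE_completion[OF ae] unfolding S_def by eventually_elim auto
  then have "negligible S"
    using \<open>open S\<close> by (simp add: negligible_iff_null_sets AE_iff_null_sets borel_open)
  ultimately show False by contradiction
qed

text \<open>The right side is the maximum of the left, attained at 1 + x = c / k; the estimate is ln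
  y \<le> y - 1 at y = (1 + x) k / c. It lets an exponential factor control the weight (1 +
  x)^c.\<close>

lemma one_plus_powr_mult_exp_bound:
  fixes c k x :: real
  assumes "c > 0" "k > 0" "x > 0"
  shows "(1 + x) powr c * exp (- (k * x)) \<le> exp (k - c - c * ln (k / c))"
proof -
  have "ln ((1 + x) * (k / c)) \<le> (1 + x) * (k / c) - 1"
    using assms by (intro ln_le_minus_one) auto
  then have "ln (1 + x) + ln (k / c) \<le> (1 + x) * (k / c) - 1"
    using assms by (subst (asm) ln_mult) auto
  then have "c * (ln (1 + x) + ln (k / c)) \<le> c * ((1 + x) * (k / c) - 1)"
    using assms by (intro mult_left_mono) auto
  then have "c * ln (1 + x) - k * x \<le> k - c - c * ln (k / c)"
    using assms by (simp add: algebra_simps add_divide_distrib)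
  moreover have "(1 + x) powr c * exp (- (k * x)) = exp (c * ln (1 + x) - k * x)"
    using assms by (simp add: powr_def exp_diff exp_minus field_simps)
  ultimately show ?thesis by simp
qed

text \<open>For \<open>a \<le> 0\<close> the kernel dominates a multiple of 1 / x near 0, and that
  integral diverges logarithmically. This is what forces the first Kummer parameter to be
  positive.\<close>

lemma nn_integral_kummer_kernel_top:
  assumes a: "a \<le> 0" and c: "c > 0"
  shows "(\<integral>\<^sup>+x. ennreal (kummer_kernel a b c x) \<partial>lborel) = \<infinity>"
proof (rule ccontr)
  assume "(\<integral>\<^sup>+x. ennreal (kummer_kernel a b c x) \<partial>lborel) \<noteq> \<infinity>"
  then obtain K where K: "K \<ge> 0" "(\<integral>\<^sup>+x. ennreal (kummer_kernel a b c x) \<partial>lborel) = ennreal K"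
    by (metis ennreal_cases infinity_ennreal_def)
  \<comment> \<open>A lower bound on (0, 1] for the factors other than the power of
    \<open>x\<close>; the maximum with 0 covers a negative exponent \<open>a + b\<close>.\<close>
  define m where "m = exp (- c) / 2 powr (max 0 (a + b))"
  have m: "m > 0" unfolding m_def by simp
  \<comment> \<open>Chosen so that the integral of \<open>m / x\<close> over [\<epsilon>, 1] is
    exactly \<open>K + 1\<close>, more than the supposed total.\<close>
  define \<epsilon> where "\<epsilon> = exp (- (K + 1) / m)"
  have \<epsilon>: "0 < \<epsilon>" "\<epsilon> \<le> 1"
    unfolding \<epsilon>_def using K m by (auto intro!: divide_nonpos_pos)
  have lower: "m * (1 / x) \<le> kummer_kernel a b c x" if x: "0 < x" "x \<le> 1" for x
  proof -
    have "1 / x \<le> x powr (a - 1)"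
    proof -
      have "x powr (-1) \<le> x powr (a - 1)" using a x by (intro powr_mono') auto
      then show ?thesis using x by (simp add: powr_minus_divide)
    qed
    moreover have "exp (- c) \<le> exp (- c * x)" using x c by simp
    moreover have "1 / 2 powr (max 0 (a + b)) \<le> 1 / (1 + x) powr (a + b)"
    proof -
      have "(1 + x) powr (a + b) \<le> (1 + x) powr (max 0 (a + b))" using x by (intro powr_mono) auto
      also have "\<dots> \<le> 2 powr (max 0 (a + b))" using x by (intro powr_mono2) auto
      finally show ?thesis using x by (intro divide_left_mono) auto
    qed
    ultimately have "1 / x * exp (- c) * (1 / 2 powr (max 0 (a + b)))
        \<le> x powr (a - 1) * exp (- c * x) * (1 / (1 + x) powr (a + b))"
      using x by (intro mult_mono) auto
    then show ?thesis using x by (simp add: kummer_kernel_def m_def field_simps)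
  qed
  have "ennreal (m * ln 1 - m * ln \<epsilon>) = (\<integral>\<^sup>+x. ennreal (m * (1 / x)) * indicator {\<epsilon>..1} x \<partial>lborel)"
    using \<epsilon> m by (intro nn_integral_FTC_Icc[symmetric])
      (auto intro!: derivative_eq_intros simp: field_simps has_real_derivative_iff_has_vector_derivative[symmetric])
  also have "\<dots> \<le> (\<integral>\<^sup>+x. ennreal (kummer_kernel a b c x) \<partial>lborel)"
    using lower \<epsilon> by (intro nn_integral_mono) (auto simp: indicator_def intro!: ennreal_leI)
  also have "\<dots> = ennreal K" by (rule K)
  finally have "m * ln 1 - m * ln \<epsilon> \<le> K" using K by (simp add: ennreal_le_iff)
  moreover have "m * ln 1 - m * ln \<epsilon> = K + 1" unfolding \<epsilon>_def using m by simp
  ultimately show False by simp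
qed

text \<open>For the weighted measure \<open>N\<close> with transform \<open>G\<close>, the
  hypothesis reads (1 + u) G'(- l u) = \<alpha> G(- l u). Its solutions are multiples of (1 + u)^(-
  \<alpha> l), the transforms of multiples of the gamma kernel with shape \<alpha> l and rate
  \<open>l\<close>. Removing the weight leaves a Kummer kernel, and its finite mass makes the first
  parameter positive.\<close>

lemma kummer_distribution_unique:
  fixes \<mu> :: "real measure" and r c l \<alpha> :: real
  assumes prob: "prob_space \<mu>" and sets: "sets \<mu> = sets borel" and pos: "AE x in \<mu>. x > 0"
    and c: "c > 0" and l: "l > 0" and \<alpha>: "\<alpha> > 0"
    and fin: "(\<integral>\<^sup>+x. ennreal (x powr r) \<partial>\<mu>) < \<infinity>"
    and eq: "AE u in lborel. u > 0 \<longrightarrow>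
      ennreal (1 + u) * (\<integral>\<^sup>+x. ennreal (x powr (r + 1) * (1 + x) powr c * exp (- (l * u * x))) \<partial>\<mu>)
      = ennreal \<alpha> * (\<integral>\<^sup>+x. ennreal (x powr r * (1 + x) powr c * exp (- (l * u * x))) \<partial>\<mu>)"
  shows "\<alpha> * l - r > 0"
    and "\<mu> = density lborel (\<lambda>x. ennreal (normalized (kummer_kernel (\<alpha> * l - r) (c - \<alpha> * l + r) l) x))"
proof -
  note [measurable_cong] = sets
  define p where "p = \<alpha> * l"
  have p: "p > 0" unfolding p_def using \<alpha> l by simp
  define w where "w = (\<lambda>x::real. x powr r * (1 + x) powr c)"
  have w_meas [measurable]: "w \<in> borel_measurable borel" unfolding w_def by measurable
  define N where "N = density \<mu> (\<lambda>x. ennreal (w x))"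
  have N_sets: "sets N = sets borel" unfolding N_def using sets by simp
  note [measurable_cong] = N_sets
  have N_pos: "AE x in N. x > 0" unfolding N_def using pos by (subst AE_density) auto
  have N_nn: "(\<integral>\<^sup>+x. ennreal (f x) \<partial>N) = (\<integral>\<^sup>+x. ennreal (w x * f x) \<partial>\<mu>)"
    if [measurable]: "f \<in> borel_measurable borel" for f
    unfolding N_def by (subst nn_integral_density) (auto simp: w_def ennreal_mult')
  have exp_meas: "(\<lambda>x::real. exp (\<theta> * x)) \<in> borel_measurable borel"
    "(\<lambda>x::real. x * exp (\<theta> * x)) \<in> borel_measurable borel" for \<theta>
    by measurable
  \<comment> \<open>The total mass of \<open>N\<close> is not known to be finite, so its transform
    is studied at negative \<open>\<theta>\<close> only, where the exponential absorbs (1 + x)^c and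
    the \<open>r\<close>-th moment of \<open>\<mu>\<close> suffices.\<close>
  have N_fin: "integrable N (\<lambda>x. exp (\<theta> * x))" if "\<theta> < 0" for \<theta>
  proof -
    define B where "B = exp (- \<theta> - c - c * ln (- \<theta> / c))"
    have "(\<integral>\<^sup>+x. ennreal (exp (\<theta> * x)) \<partial>N) \<le> (\<integral>\<^sup>+x. ennreal B * ennreal (x powr r) \<partial>\<mu>)"
      unfolding N_nn[OF exp_meas(1)]
    proof (rule nn_integral_mono_AE, use pos in eventually_elim)
      case (elim x)
      have "(1 + x) powr c * exp (\<theta> * x) \<le> B"
        unfolding B_def using one_plus_powr_mult_exp_bound[of c "- \<theta>" x] that c elim by simp
      then have "x powr r * ((1 + x) powr c * exp (\<theta> * x)) \<le> x powr r * B"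
        by (intro mult_left_mono) auto
      then show ?case unfolding w_def B_def by (simp add: ennreal_mult'[symmetric] mult_ac)
    qed
    also have "\<dots> < \<infinity>" using fin by (simp add: nn_integral_cmult ennreal_mult_less_top)
    finally show ?thesis by (auto simp: integrable_iff_bounded)
  qed
  define G where "G = (\<lambda>\<theta>. LINT x|N. exp (\<theta> * x))"
  define D where "D = (\<lambda>\<theta>. LINT x|N. x * exp (\<theta> * x))"
  have G_nn: "(\<integral>\<^sup>+x. ennreal (exp (\<theta> * x)) \<partial>N) = ennreal (G \<theta>)" if "\<theta> < 0" for \<theta>
    unfolding G_def using N_fin[OF that] by (simp add: nn_integral_eq_integral)
  have G_deriv: "(G has_real_derivative D \<theta>) (at \<theta>)" if "\<theta> < 0" for \<theta>
    unfolding G_def D_def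
    by (rule has_real_derivative_laplace[OF N_sets, of "\<theta> - 1" 0]) (use N_fin that in auto)
  have D_cont: "isCont D \<theta>" if "\<theta> < 0" for \<theta>
    unfolding D_def
    by (rule isCont_laplace_deriv[OF N_sets N_pos, of "\<theta> - 1" 0]) (use N_fin that in auto)
  have D_int: "integrable N (\<lambda>x. x * exp (\<theta> * x))" if "\<theta> < 0" for \<theta>
  proof -
    have "complex_integrable N (\<lambda>x. complex_of_real x * exp (complex_of_real \<theta> * complex_of_real x))"
      by (rule integrable_mult_exp_complex[OF N_sets, of "\<theta> - 1" 0]) (use N_fin that in auto)
    then show ?thesis
      unfolding of_real_mult[symmetric] exp_of_real complex_of_real_integrable_eq .
  qed
  have D_nn: "(\<integral>\<^sup>+x. ennreal (x * exp (\<theta> * x)) \<partial>N) = ennreal (D \<theta>)" if "\<theta> < 0" for \<theta>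
    unfolding D_def using D_int[OF that] N_pos by (intro nn_integral_eq_integral) auto
  have G0: "G \<theta> \<ge> 0" for \<theta> unfolding G_def by simp
  have D0: "D \<theta> \<ge> 0" for \<theta> unfolding D_def using N_pos by (intro integral_nonneg_AE) auto
  \<comment> \<open>Both transforms are finite at \<open>- (l * u)\<close>, so the extended identity
    becomes one between reals.\<close>
  have "AE u in lborel. u > 0 \<longrightarrow> (1 + u) * D (- (l * u)) - \<alpha> * G (- (l * u)) = 0"
    using eq
  proof eventually_elim
    case (elim u)
    show ?case
    proof
      assume u: "u > 0"
      then have lu: "- (l * u) < 0" using l by simp
      have "(\<integral>\<^sup>+x. ennreal (x powr (r + 1) * (1 + x) powr c * exp (- (l * u * x))) \<partial>\<mu>)
          = (\<integral>\<^sup>+x. ennreal (x * exp (- (l * u) * x)) \<partial>N)"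
        unfolding N_nn[OF exp_meas(2)]
        by (rule nn_integral_cong_AE, use pos in eventually_elim)
          (simp add: w_def ennreal_mult'[symmetric] powr_add mult_ac)
      moreover have "(\<integral>\<^sup>+x. ennreal (x powr r * (1 + x) powr c * exp (- (l * u * x))) \<partial>\<mu>)
          = (\<integral>\<^sup>+x. ennreal (exp (- (l * u) * x)) \<partial>N)"
        unfolding N_nn[OF exp_meas(1)]
        by (rule nn_integral_cong) (simp add: w_def ennreal_mult'[symmetric] mult_ac)
      ultimately have "ennreal (1 + u) * ennreal (D (- (l * u))) = ennreal \<alpha> * ennreal (G (- (l * u)))"
        using elim u D_nn[OF lu] G_nn[OF lu] by simp
      then have "ennreal ((1 + u) * D (- (l * u))) = ennreal (\<alpha> * G (- (l * u)))"
        using u \<alpha> by (simp add: ennreal_mult')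
      then show "(1 + u) * D (- (l * u)) - \<alpha> * G (- (l * u)) = 0"
        using u \<alpha> G0[of "- (l * u)"] D0[of "- (l * u)"] by (subst (asm) ennreal_inj) auto
    qed
  qed
  \<comment> \<open>Continuity upgrades the identity from almost every to every
    \<open>u > 0\<close>.\<close>
  moreover have "continuous_on {0<..} (\<lambda>u. (1 + u) * D (- (l * u)) - \<alpha> * G (- (l * u)))"
  proof (intro continuous_at_imp_continuous_on ballI)
    fix u :: real assume "u \<in> {0<..}"
    then have lu: "- (l * u) < 0" using l by simp
    have "isCont (\<lambda>u. D (- (l * u))) u" "isCont (\<lambda>u. G (- (l * u))) u"
      using isCont_o2[where f = "\<lambda>u. - (l * u)" and a = u] D_cont[OF lu] DERIV_isCont[OF G_deriv[OF lu]]
      by (auto intro!: continuous_intros)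
    then show "isCont (\<lambda>u. (1 + u) * D (- (l * u)) - \<alpha> * G (- (l * u))) u"
      by (intro continuous_intros)
  qed
  ultimately have ode: "(1 + u) * D (- (l * u)) = \<alpha> * G (- (l * u))" if "u > 0" for u
    using AE_lborel_eq_imp_eq[of "\<lambda>u. (1 + u) * D (- (l * u)) - \<alpha> * G (- (l * u))" u] that by simp
  \<comment> \<open>\<open>(1 + u) powr p\<close> is the integrating factor: by \<open>ode\<close>
    the derivative of the product is zero.\<close>
  have "\<exists>C. \<forall>u\<in>{0<..}. G (- (l * u)) * (1 + u) powr p = C"
  proof (rule has_field_derivative_zero_constant)
    fix u :: real assume "u \<in> {0<..}"
    then have u: "u > 0" by simp
    then have lu: "- (l * u) < 0" using l by simp
    have "((\<lambda>u. G (- (l * u))) has_real_derivative D (- (l * u)) * (- l)) (at u)"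
      by (rule DERIV_chain2[where f = G and g = "\<lambda>u. - (l * u)"], rule G_deriv[OF lu])
        (auto intro!: derivative_eq_intros)
    moreover have "((\<lambda>u. (1 + u) powr p) has_real_derivative p * (1 + u) powr (p - 1)) (at u)"
      using u by (auto intro!: derivative_eq_intros)
    ultimately have "((\<lambda>u. G (- (l * u)) * (1 + u) powr p) has_real_derivative
        D (- (l * u)) * (- l) * (1 + u) powr p + p * (1 + u) powr (p - 1) * G (- (l * u))) (at u)"
      by (rule DERIV_mult)
    moreover have "(1 + u) powr p = (1 + u) * (1 + u) powr (p - 1)"
      using u by (simp add: powr_mult_base)
    then have "D (- (l * u)) * (- l) * (1 + u) powr p + p * (1 + u) powr (p - 1) * G (- (l * u))
        = l * (1 + u) powr (p - 1) * (\<alpha> * G (- (l * u)) - (1 + u) * D (- (l * u)))"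
      unfolding p_def by (simp add: algebra_simps)
    ultimately show "((\<lambda>u. G (- (l * u)) * (1 + u) powr p) has_real_derivative 0) (at u within {0<..})"
      using ode[OF u] by (auto intro: has_field_derivative_at_within)
  qed simp
  then obtain C where C: "\<And>u. u > 0 \<Longrightarrow> G (- (l * u)) * (1 + u) powr p = C" by auto
  have C0: "C \<ge> 0" using C[of 1] G0[of "- l"] by auto
  have G_eq: "G \<theta> = C * l powr p / (l - \<theta>) powr p" if "\<theta> < 0" for \<theta>
  proof -
    have "G \<theta> * (1 - \<theta> / l) powr p = C" using C[of "- \<theta> / l"] that l by (simp add: field_simps)
    moreover have "1 - \<theta> / l = (l - \<theta>) / l" using l by (simp add: field_simps)
    ultimately show ?thesis using that l by (simp add: powr_divide field_simps)
  qed
  \<comment> \<open>Scales the transform \<open>Gamma p / (l - \<theta>) powr p\<close> of the gamma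
    kernel to \<open>G \<theta>\<close>.\<close>
  define K where "K = C * l powr p / Gamma p"
  have K0: "K \<ge> 0" unfolding K_def using C0 p by (simp add: Gamma_real_pos less_imp_le)
  have N_eq: "N = density lborel (\<lambda>x. ennreal (K * gamma_kernel p l x))"
  \<comment> \<open>Any open interval of negative parameters would serve for uniqueness.\<close>
  proof (rule measure_eqI_laplace[OF N_sets, of _ "-1" 0])
    fix \<theta> :: real assume \<theta>: "-1 < \<theta>" "\<theta> < 0"
    have "(\<integral>\<^sup>+x. ennreal (exp (\<theta> * x)) \<partial>density lborel (\<lambda>x. ennreal (K * gamma_kernel p l x)))
        = (\<integral>\<^sup>+x. ennreal K * ennreal (gamma_kernel p (l - \<theta>) x) \<partial>lborel)"
      using K0 by (subst nn_integral_density)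
        (auto simp: ennreal_mult'[symmetric] exp_mult_gamma_kernel[symmetric] mult_ac)
    also have "\<dots> = ennreal (K * (Gamma p / (l - \<theta>) powr p))"
      using \<theta> p l K0 unfolding ennreal_mult'[OF K0] by (simp add: nn_integral_cmult nn_integral_gamma_kernel)
    also have "K * (Gamma p / (l - \<theta>) powr p) = G \<theta>"
      unfolding K_def G_eq[OF \<theta>(2)] using p by (simp add: Gamma_real_pos less_imp_neq[THEN not_sym])
    finally have *: "(\<integral>\<^sup>+x. ennreal (exp (\<theta> * x)) \<partial>density lborel (\<lambda>x. ennreal (K * gamma_kernel p l x)))
        = ennreal (G \<theta>)" .
    then show "(\<integral>\<^sup>+x. ennreal (exp (\<theta> * x)) \<partial>density lborel (\<lambda>x. ennreal (K * gamma_kernel p l x))) < \<infinity>"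
      by simp
    show "(\<integral>\<^sup>+x. ennreal (exp (\<theta> * x)) \<partial>N)
        = (\<integral>\<^sup>+x. ennreal (exp (\<theta> * x)) \<partial>density lborel (\<lambda>x. ennreal (K * gamma_kernel p l x)))"
      unfolding * by (rule G_nn[OF \<theta>(2)])
  qed auto
  \<comment> \<open>With \<open>b\<close> below, \<open>a + b = c\<close>: the exponent of 1 + x
    comes from the weight alone, and dividing by x^r lowers the shape from \<open>p\<close> to
    \<open>p - r\<close>.\<close>
  define a where "a = p - r"
  define b where "b = c - p + r"
  \<comment> \<open>The reciprocal of \<open>w\<close> on the half-line, cut off to agree with the
    support of the Kummer kernel.\<close>
  define v where "v = (\<lambda>x::real. x powr (- r) * (1 + x) powr (- c) * indicator {0<..} x)"
  have [measurable]: "v \<in> borel_measurable borel" unfolding v_def by measurable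
  have "\<mu> = density \<mu> (\<lambda>x. ennreal (w x) * ennreal (v x))"
  proof -
    have "AE x in \<mu>. 1 = ennreal (w x) * ennreal (v x)"
      using pos by eventually_elim
        (simp add: w_def v_def ennreal_mult'[symmetric] powr_minus field_simps)
    then have "density \<mu> (\<lambda>x. 1) = density \<mu> (\<lambda>x. ennreal (w x) * ennreal (v x))"
      by (intro density_cong) auto
    then show ?thesis by (simp add: density_1)
  qed
  also have "\<dots> = density N (\<lambda>x. ennreal (v x))"
    unfolding N_def by (subst density_density_eq) auto
  also have "\<dots> = density lborel (\<lambda>x. ennreal (K * gamma_kernel p l x) * ennreal (v x))"
    unfolding N_eq by (subst density_density_eq) auto
  also have "\<dots> = density lborel (\<lambda>x. ennreal (K * kummer_kernel a b l x))"
  proof (rule arg_cong[of _ _ "density lborel"], rule ext)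
    fix x :: real
    show "ennreal (K * gamma_kernel p l x) * ennreal (v x) = ennreal (K * kummer_kernel a b l x)"
    proof (cases "x > 0")
      case True
      have "x powr (p - 1) * x powr (- r) = x powr (a - 1)"
        unfolding a_def by (simp add: powr_add[symmetric] algebra_simps)
      moreover have "(1 + x) powr (- c) = 1 / (1 + x) powr (a + b)"
        unfolding a_def b_def by (simp add: powr_minus_divide)
      ultimately have "gamma_kernel p l x * v x = kummer_kernel a b l x"
        using True by (simp add: gamma_kernel_def kummer_kernel_def v_def mult_ac)
      then show ?thesis
        using K0 by (simp add: ennreal_mult''[symmetric] mult.assoc v_def)
    qed (simp add: v_def kummer_kernel_def)
  qed
  finally have \<mu>_eq: "\<mu> = density lborel (\<lambda>x. ennreal (K * kummer_kernel a b l x))" .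
  have "1 = emeasure \<mu> UNIV"
    using prob_space.emeasure_space_1[OF prob] sets_eq_imp_space_eq[OF sets] by simp
  also have "\<dots> = (\<integral>\<^sup>+x. ennreal (K * kummer_kernel a b l x) \<partial>lborel)"
    unfolding \<mu>_eq by (simp add: emeasure_density)
  also have "\<dots> = ennreal K * (\<integral>\<^sup>+x. ennreal (kummer_kernel a b l x) \<partial>lborel)"
    using K0 by (simp add: ennreal_mult' nn_integral_cmult)
  finally have one: "ennreal K * (\<integral>\<^sup>+x. ennreal (kummer_kernel a b l x) \<partial>lborel) = 1" by simp
  \<comment> \<open>Mass 1 excludes \<open>K = 0\<close>, hence also an infinite integral of the
    kernel, which \<open>a \<le> 0\<close> would entail.\<close>
  then have Kpos: "K > 0" using K0 by (cases "K = 0") auto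
  then have int_fin: "(\<integral>\<^sup>+x. ennreal (kummer_kernel a b l x) \<partial>lborel) \<noteq> \<infinity>"
    using one by (auto simp: ennreal_mult_top)
  then obtain J where J: "J \<ge> 0" "(\<integral>\<^sup>+x. ennreal (kummer_kernel a b l x) \<partial>lborel) = ennreal J"
    by (metis ennreal_cases infinity_ennreal_def)
  have KJ: "K * J = 1" using one J K0 by (simp add: ennreal_mult'[symmetric])
  have "a > 0" using nn_integral_kummer_kernel_top[of a l b] int_fin l by force
  then show "\<alpha> * l - r > 0" unfolding a_def p_def .
  have "normalized (kummer_kernel a b l) x = K * kummer_kernel a b l x" for x
  proof -
    have "normalized (kummer_kernel a b l) x = kummer_kernel a b l x / J"
      using J by (intro normalized_eqI) auto
    also have "\<dots> = K * kummer_kernel a b l x" using KJ by (cases "J = 0") (auto simp: field_simps)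
    finally show ?thesis .
  qed
  then show "\<mu> = density lborel (\<lambda>x. ennreal (normalized (kummer_kernel (\<alpha> * l - r) (c - \<alpha> * l + r) l) x))"
    using \<mu>_eq unfolding a_def b_def p_def by simp
qed

subsection \<open>Moments of the gamma factor\<close>

text \<open>The test functions u^n separate the integrals in \<open>x\<close> and \<open>y\<close>.
  Eliminating the former shows that consecutive moment ratios of \<open>\<nu>\<close> differ by
  \<open>\<delta>\<close>. The recurrence alone leaves the sign of \<open>\<delta>\<close> open; the
  positive variance of \<open>\<nu>\<close> settles it.\<close>

lemma moment_recurrence:
  fixes \<mu> \<nu> :: "real measure" and r :: real and \<alpha> :: "real \<Rightarrow> real"
  assumes prob: "prob_space \<mu>" "prob_space \<nu>"
    and sets: "sets \<mu> = sets borel" "sets \<nu> = sets borel"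
    and pos: "AE x in \<mu>. x > 0" "AE y in \<nu>. y > 0"
    and nondeg: "\<And>k. \<not> (AE y in \<nu>. y = k)"
    and \<alpha>: "\<alpha> r > 0" "\<alpha> (r + 1) > 0"
    and fin: "\<And>s. s \<in> {r - 1, r, r + 1} \<Longrightarrow> (\<integral>\<^sup>+x. ennreal (x powr s) \<partial>\<mu>) < \<infinity>"
    and eq: "\<And>h s. h \<in> borel_measurable borel \<Longrightarrow> s \<in> {r, r + 1} \<Longrightarrow>
      (\<integral>\<^sup>+x. \<integral>\<^sup>+y. h (y / (1 + x)) * ennreal ((1 + y / (1 + x)) * x powr s) \<partial>\<nu> \<partial>\<mu>)
      = ennreal (\<alpha> s) * (\<integral>\<^sup>+x. \<integral>\<^sup>+y. h (y / (1 + x)) * ennreal (x powr (s - 1)) \<partial>\<nu> \<partial>\<mu>)"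
  defines "\<delta> \<equiv> \<alpha> (r + 1) - \<alpha> r"
  shows "\<delta> > 0"
    and "\<exists>c>0. \<forall>n. (\<integral>\<^sup>+y. ennreal (y ^ Suc n) \<partial>\<nu>)
        = ennreal ((c + real n) * \<delta>) * (\<integral>\<^sup>+y. ennreal (y ^ n) \<partial>\<nu>)"
proof -
  note [measurable_cong] = sets
  interpret \<mu>: prob_space \<mu> by (rule prob)
  interpret \<nu>: prob_space \<nu> by (rule prob)
  define \<Phi> where "\<Phi> = (\<lambda>s n. \<integral>\<^sup>+x. ennreal (x powr s / (1 + x) ^ n) \<partial>\<mu>)"
  define m where "m = (\<lambda>n. \<integral>\<^sup>+y. ennreal (y ^ n) \<partial>\<nu>)"
  have \<Phi>_fin: "\<Phi> s n < \<infinity>" if s: "s \<in> {r - 1, r, r + 1}" for s n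
  proof -
    have "\<Phi> s n \<le> (\<integral>\<^sup>+x. ennreal (x powr s) \<partial>\<mu>)"
      unfolding \<Phi>_def
    proof (rule nn_integral_mono_AE, use pos(1) in eventually_elim)
      case (elim x)
      then have "(1 + x) ^ n \<ge> 1" by (intro one_le_power) auto
      then have "x powr s / (1 + x) ^ n \<le> x powr s / 1" by (intro divide_left_mono) auto
      then show ?case by (intro ennreal_leI) simp
    qed
    then show ?thesis using fin[OF s] by (rule le_less_trans)
  qed
  have \<Phi>_pos: "\<Phi> s n \<noteq> 0" for s n
  proof
    assume "\<Phi> s n = 0"
    then have "AE x in \<mu>. ennreal (x powr s / (1 + x) ^ n) = 0"
      unfolding \<Phi>_def by (subst (asm) nn_integral_0_iff_AE) auto
    with pos(1) have "AE x in \<mu>. False"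
    proof eventually_elim
      case (elim x)
      then have "x powr s / (1 + x) ^ n > 0" by (intro divide_pos_pos zero_less_power) auto
      with elim show ?case by (simp add: ennreal_eq_0_iff)
    qed
    then show False by simp
  qed
  have m_pos: "m n \<noteq> 0" for n
  proof
    assume "m n = 0"
    then have "AE y in \<nu>. ennreal (y ^ n) = 0"
      unfolding m_def by (subst (asm) nn_integral_0_iff_AE) auto
    with pos(2) have "AE y in \<nu>. False"
    proof eventually_elim
      case (elim y)
      then have "y ^ n > 0" by (intro zero_less_power)
      with elim show ?case by (simp add: ennreal_eq_0_iff)
    qed
    then show False by simp
  qed
  have m_eq: "\<Phi> s n * m n + \<Phi> s (Suc n) * m (Suc n) = ennreal (\<alpha> s) * (\<Phi> (s - 1) n * m n)"
    if s: "s \<in> {r, r + 1}" for s n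
  proof -
    have prod: "(\<integral>\<^sup>+x. \<integral>\<^sup>+y. ennreal (x powr t / (1 + x) ^ k) * ennreal (y ^ k) \<partial>\<nu> \<partial>\<mu>) = \<Phi> t k * m k" for t k
      unfolding \<Phi>_def m_def by (simp add: nn_integral_cmult nn_integral_multc)
    have "(\<integral>\<^sup>+x. \<integral>\<^sup>+y. ennreal ((y / (1 + x)) ^ n) * ennreal ((1 + y / (1 + x)) * x powr s) \<partial>\<nu> \<partial>\<mu>)
        = (\<integral>\<^sup>+x. \<integral>\<^sup>+y. ennreal (x powr s / (1 + x) ^ n) * ennreal (y ^ n)
            + ennreal (x powr s / (1 + x) ^ Suc n) * ennreal (y ^ Suc n) \<partial>\<nu> \<partial>\<mu>)"
    proof (rule nn_integral_cong_AE, use pos(1) in eventually_elim)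
      case (elim x)
      show ?case
      proof (rule nn_integral_cong_AE, use pos(2) in eventually_elim)
        case (elim y)
        have "(y / (1 + x)) ^ n * ((1 + y / (1 + x)) * x powr s)
            = x powr s / (1 + x) ^ n * y ^ n + x powr s / (1 + x) ^ Suc n * y ^ Suc n"
          by (simp add: power_divide algebra_simps)
        then show ?case
          using \<open>x > 0\<close> \<open>y > 0\<close> by (simp add: ennreal_mult[symmetric] ennreal_plus[symmetric] del: ennreal_plus power_Suc)
      qed
    qed
    also have "\<dots> = \<Phi> s n * m n + \<Phi> s (Suc n) * m (Suc n)"
      unfolding prod[symmetric] by (simp add: nn_integral_add)
    finally have lhs: "(\<integral>\<^sup>+x. \<integral>\<^sup>+y. ennreal ((y / (1 + x)) ^ n) * ennreal ((1 + y / (1 + x)) * x powr s) \<partial>\<nu> \<partial>\<mu>)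
        = \<Phi> s n * m n + \<Phi> s (Suc n) * m (Suc n)" .
    have "(\<integral>\<^sup>+x. \<integral>\<^sup>+y. ennreal ((y / (1 + x)) ^ n) * ennreal (x powr (s - 1)) \<partial>\<nu> \<partial>\<mu>)
        = (\<integral>\<^sup>+x. \<integral>\<^sup>+y. ennreal (x powr (s - 1) / (1 + x) ^ n) * ennreal (y ^ n) \<partial>\<nu> \<partial>\<mu>)"
    proof (rule nn_integral_cong_AE, use pos(1) in eventually_elim)
      case (elim x)
      show ?case
      proof (rule nn_integral_cong_AE, use pos(2) in eventually_elim)
        case (elim y)
        show ?case
          using \<open>x > 0\<close> \<open>y > 0\<close> by (simp add: ennreal_mult[symmetric] power_divide mult_ac)
      qed
    qed
    also have "\<dots> = \<Phi> (s - 1) n * m n" by (rule prod)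
    finally show ?thesis
      using eq[of "\<lambda>u. ennreal (u ^ n)" s] s lhs by simp
  qed
  \<comment> \<open>\<open>m_eq\<close> holds among extended reals, so a finite \<open>m n\<close>
    bounds \<open>\<Phi> r (Suc n) * m (Suc n)\<close>, and the factor
    \<open>\<Phi> r (Suc n)\<close> is nonzero.\<close>
  have m_fin: "m n < \<infinity>" for n
  proof (induction n)
    case 0
    show ?case unfolding m_def by (simp add: \<nu>.emeasure_space_1)
  next
    case (Suc n)
    have "\<Phi> r (Suc n) * m (Suc n) \<le> \<Phi> r n * m n + \<Phi> r (Suc n) * m (Suc n)" by simp
    also have "\<dots> = ennreal (\<alpha> r) * (\<Phi> (r - 1) n * m n)" by (intro m_eq) simp
    also have "\<dots> < \<infinity>" using Suc \<Phi>_fin[of "r - 1" n] by (simp add: ennreal_mult_less_top)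
    finally show ?case using \<Phi>_pos[of r "Suc n"] by (auto simp: ennreal_mult_less_top)
  qed
  define \<phi> where "\<phi> = (\<lambda>s n. enn2real (\<Phi> s n))"
  define M where "M = (\<lambda>n. enn2real (m n))"
  have \<phi>: "\<Phi> s n = ennreal (\<phi> s n)" "\<phi> s n > 0" if "s \<in> {r - 1, r, r + 1}" for s n
    unfolding \<phi>_def using \<Phi>_fin[OF that, of n] \<Phi>_pos[of s n]
    by (auto simp: enn2real_positive_iff zero_less_iff_neq_zero)
  have M: "m n = ennreal (M n)" "M n > 0" for n
    unfolding M_def using m_fin[of n] m_pos[of n]
    by (auto simp: enn2real_positive_iff zero_less_iff_neq_zero)
  have M_0: "M 0 = 1" unfolding M_def m_def by (simp add: \<nu>.emeasure_space_1)
  have real_eq: "\<phi> s n * M n + \<phi> s (Suc n) * M (Suc n) = \<alpha> s * (\<phi> (s - 1) n * M n)"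
    if s: "s \<in> {r, r + 1}" for s n
  proof -
    have s': "s \<in> {r - 1, r, r + 1}" "s - 1 \<in> {r - 1, r, r + 1}" and "\<alpha> s \<ge> 0"
      using s \<alpha> by auto
    then have "ennreal (\<phi> s n * M n + \<phi> s (Suc n) * M (Suc n)) = ennreal (\<alpha> s * (\<phi> (s - 1) n * M n))"
      using m_eq[OF s, of n] \<phi>[OF s'(1)] \<phi>[OF s'(2)] M
      by (simp add: ennreal_mult less_imp_le)
    then show ?thesis
      using \<phi>[OF s'(1)] \<phi>[OF s'(2)] M \<open>\<alpha> s \<ge> 0\<close>
      by (subst (asm) ennreal_inj) (auto intro!: add_nonneg_nonneg mult_nonneg_nonneg simp: less_imp_le)
  qed
  \<comment> \<open>This is x^s + x^(s - 1) = (1 + x) x^(s - 1), divided by (1 + x)^(n + 1) and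
    integrated.\<close>
  have telescope: "\<phi> s (Suc n) + \<phi> (s - 1) (Suc n) = \<phi> (s - 1) n" if s: "s \<in> {r, r + 1}" for s n
  proof -
    have s': "s \<in> {r - 1, r, r + 1}" "s - 1 \<in> {r - 1, r, r + 1}" using s by auto
    have "\<Phi> s (Suc n) + \<Phi> (s - 1) (Suc n)
        = (\<integral>\<^sup>+x. ennreal (x powr s / (1 + x) ^ Suc n) + ennreal (x powr (s - 1) / (1 + x) ^ Suc n) \<partial>\<mu>)"
      unfolding \<Phi>_def by (rule nn_integral_add[symmetric]) measurable
    also have "\<dots> = \<Phi> (s - 1) n"
      unfolding \<Phi>_def
    proof (rule nn_integral_cong_AE, use pos(1) in eventually_elim)
      case (elim x)
      have "x powr s + x powr (s - 1) = (1 + x) * x powr (s - 1)"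
        using elim by (simp add: powr_mult_base algebra_simps)
      then have "x powr s / (1 + x) ^ Suc n + x powr (s - 1) / (1 + x) ^ Suc n = x powr (s - 1) / (1 + x) ^ n"
        unfolding add_divide_distrib[symmetric] using elim by simp
      then show ?case using elim by (simp add: ennreal_plus[symmetric] del: ennreal_plus power_Suc)
    qed
    finally have "ennreal (\<phi> s (Suc n) + \<phi> (s - 1) (Suc n)) = ennreal (\<phi> (s - 1) n)"
      using \<phi>[OF s'(1)] \<phi>[OF s'(2)] by (simp add: less_imp_le)
    then show ?thesis
      using \<phi>[OF s'(1)] \<phi>[OF s'(2)]
      by (subst (asm) ennreal_inj) (auto intro!: add_nonneg_nonneg simp: less_imp_le)
  qed
  define g where "g = (\<lambda>n. M (Suc n) / M n)"
  have M_Suc: "M (Suc n) = g n * M n" for n unfolding g_def using M(2)[of n] by simp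
  have ratio_eq: "\<phi> s n + \<phi> s (Suc n) * g n = \<alpha> s * \<phi> (s - 1) n" if "s \<in> {r, r + 1}" for s n
  proof -
    have "(\<phi> s n + \<phi> s (Suc n) * g n) * M n = (\<alpha> s * \<phi> (s - 1) n) * M n"
      using real_eq[OF that, of n] unfolding M_Suc by (simp add: algebra_simps)
    then show ?thesis using M(2)[of n] by simp
  qed
  have g_Suc: "g (Suc n) = g n + \<delta>" for n
  proof -
    have "\<phi> r n + \<phi> r (Suc n) * g n = \<alpha> r * \<phi> (r - 1) n"
      "\<phi> r (Suc n) + \<phi> r (Suc (Suc n)) * g (Suc n) = \<alpha> r * \<phi> (r - 1) (Suc n)"
      "\<phi> (r + 1) (Suc n) + \<phi> (r + 1) (Suc (Suc n)) * g (Suc n) = \<alpha> (r + 1) * \<phi> r (Suc n)"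
      using ratio_eq[of r n] ratio_eq[of r "Suc n"] ratio_eq[of "r + 1" "Suc n"] by simp_all
    moreover have "\<phi> (r - 1) n = \<phi> r (Suc n) + \<phi> (r - 1) (Suc n)"
      "\<phi> r n = \<phi> (r + 1) (Suc n) + \<phi> r (Suc n)"
      "\<phi> (r + 1) (Suc (Suc n)) = \<phi> r (Suc n) - \<phi> r (Suc (Suc n))"
      using telescope[of r n] telescope[of "r + 1" n] telescope[of "r + 1" "Suc n"] by simp_all
    \<comment> \<open>The first ratio relation minus the second removes
      \<open>\<phi> (r - 1)\<close>; subtracting the result from the third leaves only multiples of
      \<open>\<phi> r (Suc n)\<close>.\<close>
    ultimately have "\<phi> r (Suc n) * (g (Suc n) - (g n + \<delta>)) = 0"
      unfolding \<delta>_def by algebra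
    then show ?thesis using \<phi>(2)[of r "Suc n"] by simp
  qed
  have g_eq: "g n = g 0 + real n * \<delta>" for n
    by (induction n) (simp_all add: g_Suc algebra_simps)
  have g_0: "g 0 = M 1" unfolding g_def using M_0 by simp
  have int: "integrable \<nu> (\<lambda>y. y ^ n)" "(LINT y|\<nu>. y ^ n) = M n" for n
  proof -
    show "integrable \<nu> (\<lambda>y. y ^ n)"
    proof (rule integrableI_nonneg)
      show "AE y in \<nu>. 0 \<le> y ^ n" using pos(2) by eventually_elim simp
    qed (use m_fin[of n] in \<open>auto simp: m_def\<close>)
    show "(LINT y|\<nu>. y ^ n) = M n"
      unfolding M_def m_def using pos(2) by (intro integral_eq_nn_integral) (auto elim: eventually_mono)
  qed
  have int1: "integrable \<nu> (\<lambda>y. y)" "(LINT y|\<nu>. y) = M 1" using int[of 1] by simp_all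
  \<comment> \<open>The recurrence gives \<open>M 2 = (M 1 + \<delta>) * M 1\<close>, so this
    variance equals \<open>\<delta> * M 1\<close>; non-degeneracy makes it strictly
    positive.\<close>
  have "(LINT y|\<nu>. (y - M 1)\<^sup>2) = M 2 - (M 1)\<^sup>2"
  proof -
    have "(LINT y|\<nu>. (y - M 1)\<^sup>2) = (LINT y|\<nu>. y\<^sup>2 - 2 * M 1 * y + (M 1)\<^sup>2)"
      by (simp add: power2_eq_square algebra_simps)
    also have "\<dots> = M 2 - 2 * M 1 * M 1 + (M 1)\<^sup>2"
      using int[of 2] int1 by (simp add: \<nu>.prob_space)
    finally show ?thesis by (simp add: power2_eq_square)
  qed
  moreover have "(LINT y|\<nu>. (y - M 1)\<^sup>2) > 0"
  proof -
    have I: "integrable \<nu> (\<lambda>y. (y - M 1)\<^sup>2)"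
      using int[of 2] int1 by (simp add: power2_diff)
    have "(LINT y|\<nu>. (y - M 1)\<^sup>2) \<noteq> 0"
    proof
      assume "(LINT y|\<nu>. (y - M 1)\<^sup>2) = 0"
      then have "AE y in \<nu>. (y - M 1)\<^sup>2 = 0"
        using integral_nonneg_eq_0_iff_AE[OF I] by simp
      then have "AE y in \<nu>. y = M 1" by eventually_elim simp
      with nondeg show False by blast
    qed
    moreover have "(LINT y|\<nu>. (y - M 1)\<^sup>2) \<ge> 0" by simp
    ultimately show ?thesis by linarith
  qed
  moreover have "M 2 = (M 1 + \<delta>) * M 1"
    using M_Suc[of 1] g_Suc[of 0] g_0 by (simp add: numeral_2_eq_2)
  ultimately have "\<delta> * M 1 > 0" by (simp add: power2_eq_square algebra_simps)
  then show \<delta>: "\<delta> > 0" using M(2)[of 1] by (simp add: zero_less_mult_iff)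
  \<comment> \<open>The shape is \<open>c = M 1 / \<delta>\<close>, for then the ratio
    \<open>g n = M 1 + n * \<delta>\<close> is \<open>(c + n) * \<delta>\<close>.\<close>
  have "\<forall>n. (\<integral>\<^sup>+y. ennreal (y ^ Suc n) \<partial>\<nu>)
      = ennreal ((M 1 / \<delta> + real n) * \<delta>) * (\<integral>\<^sup>+y. ennreal (y ^ n) \<partial>\<nu>)"
  proof
    fix n
    have "M (Suc n) = ((M 1 / \<delta> + real n) * \<delta>) * M n"
      using M_Suc[of n] g_eq[of n] g_0 \<delta> by (simp add: field_simps)
    then have "m (Suc n) = ennreal ((M 1 / \<delta> + real n) * \<delta>) * m n"
      unfolding M(1) using M(2)[of n] by (simp add: ennreal_mult'')
    then show "(\<integral>\<^sup>+y. ennreal (y ^ Suc n) \<partial>\<nu>)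
      = ennreal ((M 1 / \<delta> + real n) * \<delta>) * (\<integral>\<^sup>+y. ennreal (y ^ n) \<partial>\<nu>)"
      unfolding m_def .
  qed
  moreover have "M 1 / \<delta> > 0" using M(2)[of 1] \<delta> by simp
  ultimately show "\<exists>c>0. \<forall>n. (\<integral>\<^sup>+y. ennreal (y ^ Suc n) \<partial>\<nu>)
      = ennreal ((c + real n) * \<delta>) * (\<integral>\<^sup>+y. ennreal (y ^ n) \<partial>\<nu>)" by blast
qed

subsection \<open>The regression identities\<close>

text \<open>Substituting y = (1 + x) u makes the ratio the integration variable. The gamma kernel
  reproduces itself up to (1 + x)^c exp (- l u x), which is the source of the weight and of the
  Laplace transforms in \<open>x\<close>.\<close>

lemma nn_integral_gamma_rescale:
  fixes F :: "real \<Rightarrow> ennreal"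
  assumes [measurable]: "F \<in> borel_measurable borel" and x: "x > 0" and K: "K > 0"
  shows "(\<integral>\<^sup>+y. F (y / (1 + x)) \<partial>density lborel (\<lambda>y. ennreal (K * gamma_kernel c l y)))
    = (\<integral>\<^sup>+u. ennreal (K * gamma_kernel c l u) * (ennreal ((1 + x) powr c * exp (- (l * u * x))) * F u) \<partial>lborel)"
proof -
  have scale: "(1 + x) * gamma_kernel c l ((1 + x) * u)
      = gamma_kernel c l u * ((1 + x) powr c * exp (- (l * u * x)))" for u
  proof (cases "u > 0")
    case True
    have "(1 + x) * (1 + x) powr (c - 1) = (1 + x) powr c"
      using x by (simp add: powr_mult_base)
    moreover have "exp (- l * ((1 + x) * u)) = exp (- l * u) * exp (- (l * u * x))"
      by (simp add: exp_add[symmetric] algebra_simps)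
    ultimately show ?thesis
      using True x by (simp add: gamma_kernel_def powr_mult mult_ac)
  next
    case False
    then have "(1 + x) * u \<le> 0" using x by (simp add: mult_nonneg_nonpos)
    then show ?thesis using False by (simp add: gamma_kernel_def)
  qed
  have "(\<integral>\<^sup>+y. F (y / (1 + x)) \<partial>density lborel (\<lambda>y. ennreal (K * gamma_kernel c l y)))
      = (\<integral>\<^sup>+y. ennreal (K * gamma_kernel c l y) * F (y / (1 + x)) \<partial>lborel)"
    by (subst nn_integral_density) auto
  also have "\<dots> = ennreal (1 + x) *
      (\<integral>\<^sup>+u. ennreal (K * gamma_kernel c l ((1 + x) * u)) * F u \<partial>lborel)"
    using nn_integral_real_affine[of "\<lambda>y. ennreal (K * gamma_kernel c l y) * F (y / (1 + x))" "1 + x" 0] x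
    by simp
  also have "\<dots> = (\<integral>\<^sup>+u. ennreal (1 + x) * (ennreal (K * gamma_kernel c l ((1 + x) * u)) * F u) \<partial>lborel)"
    by (rule nn_integral_cmult[symmetric]) measurable
  also have "\<dots> = (\<integral>\<^sup>+u. ennreal (K * gamma_kernel c l u) *
      (ennreal ((1 + x) powr c * exp (- (l * u * x))) * F u) \<partial>lborel)"
  proof (rule nn_integral_cong)
    fix u
    have "ennreal (1 + x) * ennreal (K * gamma_kernel c l ((1 + x) * u))
        = ennreal (K * ((1 + x) * gamma_kernel c l ((1 + x) * u)))"
      using x K by (subst ennreal_mult'[symmetric]) (auto simp: mult_ac)
    also have "\<dots> = ennreal (K * gamma_kernel c l u) * ennreal ((1 + x) powr c * exp (- (l * u * x)))"
      unfolding scale using K by (simp add: ennreal_mult'[symmetric] mult_ac)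
    finally show "ennreal (1 + x) * (ennreal (K * gamma_kernel c l ((1 + x) * u)) * F u)
      = ennreal (K * gamma_kernel c l u) * (ennreal ((1 + x) powr c * exp (- (l * u * x))) * F u)"
      by (simp add: mult.assoc[symmetric])
  qed
  finally show ?thesis .
qed

text \<open>Rescaling \<open>y\<close> and exchanging the integrals writes both sides as integrals
  of \<open>h\<close> against a density in \<open>u\<close>. Indicators for \<open>h\<close> show
  that the densities agree almost everywhere, and the gamma kernel cancels where it is
  positive.\<close>

lemma laplace_equation:
  fixes \<mu> :: "real measure" and c l a s :: real
  assumes prob: "prob_space \<mu>" and sets: "sets \<mu> = sets borel" and pos: "AE x in \<mu>. x > 0"
    and c: "c > 0" and l: "l > 0"
    and \<nu>: "\<nu> = density lborel (\<lambda>y. ennreal (normalized (gamma_kernel c l) y))"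
    and eq: "\<And>h. h \<in> borel_measurable borel \<Longrightarrow>
      (\<integral>\<^sup>+x. \<integral>\<^sup>+y. h (y / (1 + x)) * ennreal ((1 + y / (1 + x)) * x powr s) \<partial>\<nu> \<partial>\<mu>)
      = ennreal a * (\<integral>\<^sup>+x. \<integral>\<^sup>+y. h (y / (1 + x)) * ennreal (x powr (s - 1)) \<partial>\<nu> \<partial>\<mu>)"
  shows "AE u in lborel. u > 0 \<longrightarrow>
      ennreal (1 + u) * (\<integral>\<^sup>+x. ennreal (x powr s * (1 + x) powr c * exp (- (l * u * x))) \<partial>\<mu>)
      = ennreal a * (\<integral>\<^sup>+x. ennreal (x powr (s - 1) * (1 + x) powr c * exp (- (l * u * x))) \<partial>\<mu>)"
proof -
  note [measurable_cong] = sets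
  interpret \<mu>: prob_space \<mu> by (rule prob)
  interpret pair_sigma_finite lborel \<mu> ..
  define K where "K = 1 / (LINT y|lborel. gamma_kernel c l y)"
  have K: "K > 0"
    unfolding K_def using c l
    by (simp add: integral_eq_nn_integral nn_integral_gamma_kernel Gamma_real_pos less_imp_le)
  have \<nu>_eq: "\<nu> = density lborel (\<lambda>y. ennreal (K * gamma_kernel c l y))"
    unfolding \<nu> normalized_def K_def by simp
  define \<Lambda> where "\<Lambda> = (\<lambda>t u. \<integral>\<^sup>+x. ennreal (x powr t * (1 + x) powr c * exp (- (l * u * x))) \<partial>\<mu>)"
  have [measurable]: "\<Lambda> t \<in> borel_measurable borel" for t
    unfolding \<Lambda>_def by measurable
  have swap: "(\<integral>\<^sup>+x. \<integral>\<^sup>+y. f (y / (1 + x)) * ennreal (x powr t) \<partial>\<nu> \<partial>\<mu>)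
      = (\<integral>\<^sup>+u. f u * (ennreal (K * gamma_kernel c l u) * \<Lambda> t u) \<partial>lborel)"
    if f [measurable]: "f \<in> borel_measurable borel" for f t
  proof -
    have "(\<integral>\<^sup>+x. \<integral>\<^sup>+y. f (y / (1 + x)) * ennreal (x powr t) \<partial>\<nu> \<partial>\<mu>)
      = (\<integral>\<^sup>+x. \<integral>\<^sup>+u. f u * ennreal (K * gamma_kernel c l u) *
          ennreal (x powr t * (1 + x) powr c * exp (- (l * u * x))) \<partial>lborel \<partial>\<mu>)"
    proof (rule nn_integral_cong_AE, use pos in eventually_elim)
      case (elim x)
      have "(\<integral>\<^sup>+y. f (y / (1 + x)) * ennreal (x powr t) \<partial>\<nu>)
        = (\<integral>\<^sup>+u. ennreal (K * gamma_kernel c l u) *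
            (ennreal ((1 + x) powr c * exp (- (l * u * x))) * (f u * ennreal (x powr t))) \<partial>lborel)"
        unfolding \<nu>_eq by (rule nn_integral_gamma_rescale[of "\<lambda>u. f u * ennreal (x powr t)"]) (use elim K in auto)
      also have "\<dots> = (\<integral>\<^sup>+u. f u * ennreal (K * gamma_kernel c l u) *
          ennreal (x powr t * (1 + x) powr c * exp (- (l * u * x))) \<partial>lborel)"
        by (rule nn_integral_cong) (simp add: ennreal_mult mult_ac)
      finally show ?case .
    qed
    also have "\<dots> = (\<integral>\<^sup>+u. \<integral>\<^sup>+x. f u * ennreal (K * gamma_kernel c l u) *
          ennreal (x powr t * (1 + x) powr c * exp (- (l * u * x))) \<partial>\<mu> \<partial>lborel)"
      by (rule Fubini') measurable
    also have "\<dots> = (\<integral>\<^sup>+u. f u * (ennreal (K * gamma_kernel c l u) * \<Lambda> t u) \<partial>lborel)"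
      unfolding \<Lambda>_def by (rule nn_integral_cong) (simp add: nn_integral_cmult mult.assoc)
    finally show ?thesis .
  qed
  define P where "P = (\<lambda>u. ennreal (1 + u) * (ennreal (K * gamma_kernel c l u) * \<Lambda> s u))"
  define Q where "Q = (\<lambda>u. ennreal a * (ennreal (K * gamma_kernel c l u) * \<Lambda> (s - 1) u))"
  have [measurable]: "P \<in> borel_measurable borel" "Q \<in> borel_measurable borel"
    unfolding P_def Q_def by measurable
  have "density lborel P = density lborel Q"
  proof (rule measure_eqI)
    fix A assume "A \<in> sets (density lborel P)"
    then have A [measurable]: "A \<in> sets borel" by simp
    have "emeasure (density lborel P) A
        = (\<integral>\<^sup>+u. (indicator A u * ennreal (1 + u)) * (ennreal (K * gamma_kernel c l u) * \<Lambda> s u) \<partial>lborel)"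
      by (simp add: emeasure_density P_def mult_ac)
    also have "\<dots> = (\<integral>\<^sup>+x. \<integral>\<^sup>+y. (indicator A (y / (1 + x)) * ennreal (1 + y / (1 + x))) * ennreal (x powr s) \<partial>\<nu> \<partial>\<mu>)"
      by (rule swap[of "\<lambda>u. indicator A u * ennreal (1 + u)", symmetric]) measurable
    also have "\<dots> = (\<integral>\<^sup>+x. \<integral>\<^sup>+y. indicator A (y / (1 + x)) * ennreal ((1 + y / (1 + x)) * x powr s) \<partial>\<nu> \<partial>\<mu>)"
      by (simp add: ennreal_mult'' mult.assoc)
    also have "\<dots> = ennreal a * (\<integral>\<^sup>+x. \<integral>\<^sup>+y. indicator A (y / (1 + x)) * ennreal (x powr (s - 1)) \<partial>\<nu> \<partial>\<mu>)"
      by (rule eq) measurable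
    also have "\<dots> = ennreal a * (\<integral>\<^sup>+u. indicator A u * (ennreal (K * gamma_kernel c l u) * \<Lambda> (s - 1) u) \<partial>lborel)"
      by (subst swap[of "indicator A"]) measurable
    also have "\<dots> = emeasure (density lborel Q) A"
      by (simp add: emeasure_density Q_def nn_integral_cmult[symmetric] mult_ac)
    finally show "emeasure (density lborel P) A = emeasure (density lborel Q) A" .
  qed simp
  \<comment> \<open>Uniqueness of densities over a \<sigma>-finite measure permits infinite values
    of \<open>P\<close> and \<open>Q\<close>.\<close>
  then have "AE u in lborel. P u = Q u"
    by (intro sigma_finite_measure.density_unique[OF sigma_finite_lborel]) auto
  then have "AE u in lborel. u > 0 \<longrightarrow> ennreal (1 + u) * \<Lambda> s u = ennreal a * \<Lambda> (s - 1) u"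
  proof eventually_elim
    case (elim u)
    show ?case
    proof
      assume "u > 0"
      then have pos: "K * gamma_kernel c l u > 0" using K by (simp add: gamma_kernel_def)
      have "ennreal (K * gamma_kernel c l u) * (ennreal (1 + u) * \<Lambda> s u)
          = ennreal (K * gamma_kernel c l u) * (ennreal a * \<Lambda> (s - 1) u)"
        using elim unfolding P_def Q_def by (simp add: mult_ac)
      then show "ennreal (1 + u) * \<Lambda> s u = ennreal a * \<Lambda> (s - 1) u"
        using pos by (subst (asm) ennreal_mult_cancel_left) (auto simp: ennreal_eq_0_iff)
    qed
  qed
  then show ?thesis unfolding \<Lambda>_def .
qed

section \<open>Proportional conditional expectations as proportional measures\<close>

lemma set_integral_cond_exp_given_proportional:
  fixes M :: "'a measure" and U Z W :: "'a \<Rightarrow> real"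
  assumes prob: "prob_space M" and U [measurable]: "U \<in> borel_measurable M"
    and Z: "integrable M Z" and W: "integrable M W"
    and eq: "AE \<omega> in M. cond_exp_given M Z U \<omega> = a * cond_exp_given M W U \<omega>"
    and B: "B \<in> sets borel"
  shows "(LINT \<omega>:U -` B \<inter> space M|M. Z \<omega>) = a * (LINT \<omega>:U -` B \<inter> space M|M. W \<omega>)"
proof -
  interpret prob_space M by (rule prob)
  define F where "F = vimage_algebra (space M) U borel"
  have F_sets: "sets F = {U -` A \<inter> space M | A. A \<in> sets borel}"
    unfolding F_def by (rule sets_vimage_algebra2) auto
  have sub: "subalgebra M F"
    unfolding subalgebra_def F_sets by (auto simp: F_def)
  interpret finite_measure_subalgebra M F
    by unfold_locales (rule sub)
  have eq': "AE \<omega> in M. real_cond_exp M F Z \<omega> = a * real_cond_exp M F W \<omega>"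
    using eq unfolding cond_exp_given_def F_def .
  define A where "A = U -` B \<inter> space M"
  have A: "A \<in> sets F" unfolding A_def F_sets using B by auto
  have [measurable]: "A \<in> sets M" unfolding A_def using B by measurable
  have "(LINT \<omega>:A|M. Z \<omega>) = (LINT \<omega>:A|M. real_cond_exp M F Z \<omega>)"
    by (rule real_cond_exp_intA[OF Z A])
  also have "\<dots> = (LINT \<omega>:A|M. a * real_cond_exp M F W \<omega>)"
    unfolding set_lebesgue_integral_def using eq'
    by (intro integral_cong_AE) (auto elim!: eventually_mono)
  also have "\<dots> = a * (LINT \<omega>:A|M. real_cond_exp M F W \<omega>)" by simp
  also have "(LINT \<omega>:A|M. real_cond_exp M F W \<omega>) = (LINT \<omega>:A|M. W \<omega>)"
    by (rule real_cond_exp_intA[OF W A, symmetric])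
  finally show ?thesis unfolding A_def .
qed

text \<open>Push the measures with densities \<open>Z\<close> and \<open>W\<close> forward along
  \<open>U\<close>: on Borel sets one is \<open>a\<close> times the other, hence also against every
  nonnegative \<open>k\<close>. No integrability of the products is required, which matters for u^n
  before the moments of \<open>Y\<close> are known to be finite.\<close>

lemma nn_integral_cond_exp_given_proportional:
  fixes M :: "'a measure" and U Z W :: "'a \<Rightarrow> real" and k :: "real \<Rightarrow> ennreal"
  assumes prob: "prob_space M" and U [measurable]: "U \<in> borel_measurable M"
    and Z: "integrable M Z" "\<And>\<omega>. Z \<omega> \<ge> 0" and W: "integrable M W" "\<And>\<omega>. W \<omega> \<ge> 0" and a: "a \<ge> 0"
    and eq: "AE \<omega> in M. cond_exp_given M Z U \<omega> = a * cond_exp_given M W U \<omega>"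
    and k [measurable]: "k \<in> borel_measurable borel"
  shows "(\<integral>\<^sup>+\<omega>. k (U \<omega>) * ennreal (Z \<omega>) \<partial>M) = ennreal a * (\<integral>\<^sup>+\<omega>. k (U \<omega>) * ennreal (W \<omega>) \<partial>M)"
proof -
  have [measurable]: "Z \<in> borel_measurable M" "W \<in> borel_measurable M" using Z W by auto
  define D where "D = (\<lambda>f. distr (density M (\<lambda>\<omega>. ennreal (f \<omega>))) borel U)"
  have D_sets: "sets (D f) = sets borel" for f unfolding D_def by simp
  have D_emeasure: "emeasure (D f) B = ennreal (LINT \<omega>:U -` B \<inter> space M|M. f \<omega>)"
    if f: "integrable M f" "\<And>\<omega>. f \<omega> \<ge> 0" and B [measurable]: "B \<in> sets borel" for f B
  proof -
    have [measurable]: "f \<in> borel_measurable M" using f by auto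
    have "emeasure (D f) B = (\<integral>\<^sup>+\<omega>. ennreal (f \<omega>) * indicator (U -` B \<inter> space M) \<omega> \<partial>M)"
      unfolding D_def by (simp add: emeasure_distr emeasure_density)
    also have "\<dots> = (\<integral>\<^sup>+\<omega>. ennreal (indicator (U -` B \<inter> space M) \<omega> *\<^sub>R f \<omega>) \<partial>M)"
      by (intro nn_integral_cong) (auto simp: indicator_def)
    also have "\<dots> = ennreal (LINT \<omega>:U -` B \<inter> space M|M. f \<omega>)"
      unfolding set_lebesgue_integral_def using f
      by (intro nn_integral_eq_integral integrable_mult_indicator) auto
    finally show ?thesis .
  qed
  have D_eq: "D Z = density (D W) (\<lambda>_. ennreal a)"
  proof (rule measure_eqI)
    fix B assume "B \<in> sets (D Z)"
    then have B: "B \<in> sets borel" by (simp add: D_sets)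
    have "emeasure (D Z) B = ennreal (a * (LINT \<omega>:U -` B \<inter> space M|M. W \<omega>))"
      unfolding D_emeasure[OF Z B]
      by (simp add: set_integral_cond_exp_given_proportional[OF prob U Z(1) W(1) eq B])
    also have "\<dots> = ennreal a * emeasure (D W) B"
      unfolding D_emeasure[OF W B] using a by (simp add: ennreal_mult')
    finally show "emeasure (D Z) B = emeasure (density (D W) (\<lambda>_. ennreal a)) B"
      using B by (simp add: emeasure_density_const D_sets)
  qed (simp add: D_sets)
  have D_nn: "(\<integral>\<^sup>+u. k u \<partial>D f) = (\<integral>\<^sup>+\<omega>. k (U \<omega>) * ennreal (f \<omega>) \<partial>M)"
    if [measurable]: "f \<in> borel_measurable M" for f
    unfolding D_def by (simp add: nn_integral_distr nn_integral_density mult.commute)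
  have "(\<integral>\<^sup>+u. k u \<partial>D Z) = ennreal a * (\<integral>\<^sup>+u. k u \<partial>D W)"
    unfolding D_eq by (simp add: nn_integral_density nn_integral_cmult D_def)
  then show ?thesis by (simp add: D_nn)
qed

text \<open>For \<open>s\<close> between 0 and \<open>p\<close>, x^s is at most the larger of 1 and
  x^p, and constants are integrable over a finite measure.\<close>

lemma (in finite_measure) integrable_powr_between:
  fixes X :: "'a \<Rightarrow> real"
  assumes [measurable]: "X \<in> borel_measurable M" and pos: "AE \<omega> in M. X \<omega> > 0"
    and int: "integrable M (\<lambda>\<omega>. X \<omega> powr p)" and s: "0 \<le> s \<and> s \<le> p \<or> p \<le> s \<and> s \<le> 0"
  shows "integrable M (\<lambda>\<omega>. X \<omega> powr s)"
proof (rule Bochner_Integration.integrable_bound)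
  show "integrable M (\<lambda>\<omega>. 1 + X \<omega> powr p)" using int by simp
  show "AE \<omega> in M. norm (X \<omega> powr s) \<le> norm (1 + X \<omega> powr p)"
    using pos
  proof eventually_elim
    case (elim \<omega>)
    have "X \<omega> powr s \<le> max (X \<omega> powr 0) (X \<omega> powr p)"
    proof (cases "X \<omega> \<ge> 1")
      case True
      then have "X \<omega> powr s \<le> X \<omega> powr (max 0 p)" using s by (intro powr_mono) auto
      then show ?thesis by (auto simp: max_def split: if_splits)
    next
      case False
      then have "X \<omega> powr s \<le> X \<omega> powr (min 0 p)" using s elim by (intro powr_mono') auto
      then show ?thesis by (auto simp: min_def split: if_splits)
    qed
    also have "\<dots> \<le> 1 + X \<omega> powr p" using elim by simp
    finally show ?case by simp
  qed
qed simp

theorem theorem2p2: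
  fixes M :: "'a measure" and X Y U V :: "'a \<Rightarrow> real"
    and r :: real and \<alpha> :: "real \<Rightarrow> real"
  assumes prob: "prob_space M"
    and indep: "prob_space.indep_var M borel X borel Y"
    and X_pos: "AE \<omega> in M. X \<omega> > 0"
    and Y_pos: "AE \<omega> in M. Y \<omega> > 0"
    and X_nondeg: "non_degenerate M X"
    and Y_nondeg: "non_degenerate M Y"
    and moments_ge: "r \<ge> 1 \<Longrightarrow>
          integrable M (\<lambda>\<omega>. X \<omega> powr (r + 1)) \<and> integrable M (\<lambda>\<omega>. Y \<omega> powr (r + 1))"
    and moments_mid: "-1 < r \<and> r < 1 \<Longrightarrow>
          integrable M (\<lambda>\<omega>. X \<omega> powr (r + 1)) \<and> integrable M (\<lambda>\<omega>. Y \<omega> powr (r + 1)) \<and>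
          integrable M (\<lambda>\<omega>. X \<omega> powr (r - 1)) \<and> integrable M (\<lambda>\<omega>. Y \<omega> powr (r - 1))"
    and moments_le: "r \<le> -1 \<Longrightarrow>
          integrable M (\<lambda>\<omega>. X \<omega> powr (r - 1)) \<and> integrable M (\<lambda>\<omega>. Y \<omega> powr (r - 1))"
    and U: "U = (\<lambda>\<omega>. Y \<omega> / (1 + X \<omega>))"
    and V: "V = (\<lambda>\<omega>. X \<omega> * (1 + U \<omega>))"
    and regression: "\<forall>s\<in>{r, r + 1}. AE \<omega> in M.
          cond_exp_given M (\<lambda>\<omega>. V \<omega> powr s) U \<omega>
            = \<alpha> s * cond_exp_given M (\<lambda>\<omega>. V \<omega> powr (s - 1)) U \<omega>"
  shows "\<alpha> (r + 1) > \<alpha> r \<and>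
         \<alpha> (r + 1) / (\<alpha> (r + 1) - \<alpha> r) > r \<and>
         (\<exists>c>0.
            kummer_distributed M X
              (\<alpha> (r + 1) / (\<alpha> (r + 1) - \<alpha> r) - r)
              (c - \<alpha> (r + 1) / (\<alpha> (r + 1) - \<alpha> r) + r)
              (1 / (\<alpha> (r + 1) - \<alpha> r)) \<and>
            gamma_distributed M Y c (1 / (\<alpha> (r + 1) - \<alpha> r)))"
proof -

  \<comment> \<open>Integrability of the powers of \<open>X\<close>, \<open>Y\<close>,
    \<open>V\<close> and positivity of the \<alpha>\<close>
  interpret prob_space M by (rule prob)
  have X_meas [measurable]: "X \<in> borel_measurable M" and Y_meas [measurable]: "Y \<in> borel_measurable M"
    using indep_var_rv1[OF indep] indep_var_rv2[OF indep] by auto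
  have U_meas [measurable]: "U \<in> borel_measurable M" unfolding U by measurable
  have V_meas [measurable]: "V \<in> borel_measurable M" unfolding V by measurable
  have U_pos: "AE \<omega> in M. U \<omega> > 0" using X_pos Y_pos by eventually_elim (simp add: U)
  have V_pos: "AE \<omega> in M. V \<omega> > 0" using X_pos U_pos by eventually_elim (simp add: V)
  \<comment> \<open>The three moment cases are regrouped: order \<open>r + 1\<close> is available
    whenever \<open>r > -1\<close>, and order \<open>r - 1\<close> for \<open>X\<close> whenever
    \<open>r < 1\<close>.\<close>
  have hi: "integrable M (\<lambda>\<omega>. X \<omega> powr (r + 1))" "integrable M (\<lambda>\<omega>. Y \<omega> powr (r + 1))" if "r > -1"
    using moments_ge moments_mid that by (meson not_less)+
  have lo: "integrable M (\<lambda>\<omega>. X \<omega> powr (r - 1))" if "r < 1"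
    using moments_mid moments_le that by (meson not_less)
  have lo_Y: "integrable M (\<lambda>\<omega>. Y \<omega> powr (r - 1))" if "r \<le> -1"
    using moments_le that by blast
  have Y_int: "integrable M (\<lambda>\<omega>. Y \<omega> powr s)" if s: "s \<in> {r - 1, r, r + 1}" "s \<ge> 0" for s
  proof (cases "r > -1")
    case True
    show ?thesis
      by (rule integrable_powr_between[OF Y_meas Y_pos hi(2)[OF True]]) (use s True in auto)
  next
    case False
    \<comment> \<open>With \<open>r \<le> -1\<close> a nonnegative exponent can only be
      \<open>r + 1 = 0\<close>, at \<open>r = -1\<close>.\<close>
    then have "s = 0" using s by auto
    then show ?thesis
      using False by (intro integrable_powr_between[OF Y_meas Y_pos lo_Y]) auto
  qed
  have X_int: "integrable M (\<lambda>\<omega>. X \<omega> powr s)" if s: "s \<in> {r - 1, r, r + 1}" for s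
  proof (cases "s \<le> 0 \<and> r < 1")
    case True
    show ?thesis
      by (rule integrable_powr_between[OF X_meas X_pos lo]) (use s True in auto)
  next
    case False
    then have "r > -1" "s \<ge> 0" using s by auto
    then show ?thesis
      by (intro integrable_powr_between[OF X_meas X_pos hi(1)]) (use s in auto)
  qed
  \<comment> \<open>Nonnegative powers use V \<le> X + Y, since V = X + X Y / (1 + X); negative
    powers use V \<ge> X.\<close>
  have V_int: "integrable M (\<lambda>\<omega>. V \<omega> powr s)" if s: "s \<in> {r - 1, r, r + 1}" for s
  proof (cases "s \<ge> 0")
    case True
    show ?thesis
    proof (rule Bochner_Integration.integrable_bound)
      show "integrable M (\<lambda>\<omega>. 2 powr s * (X \<omega> powr s + Y \<omega> powr s))"
        using X_int[OF s] Y_int[OF s True] by simp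
      show "AE \<omega> in M. norm (V \<omega> powr s) \<le> norm (2 powr s * (X \<omega> powr s + Y \<omega> powr s))"
        using X_pos Y_pos V_pos
      proof eventually_elim
        case (elim \<omega>)
        have "V \<omega> \<le> X \<omega> + Y \<omega>"
          using elim unfolding V U by (simp add: field_simps)
        also have "\<dots> \<le> 2 * max (X \<omega>) (Y \<omega>)" by simp
        finally have "V \<omega> powr s \<le> (2 * max (X \<omega>) (Y \<omega>)) powr s"
          using elim True by (intro powr_mono2) auto
        also have "\<dots> = 2 powr s * max (X \<omega>) (Y \<omega>) powr s" using elim by (simp add: powr_mult)
        also have "\<dots> \<le> 2 powr s * (X \<omega> powr s + Y \<omega> powr s)"
          by (intro mult_left_mono) (auto simp: max_def)
        finally show ?case by simp
      qed
    qed simp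
  next
    case False
    show ?thesis
    proof (rule Bochner_Integration.integrable_bound[OF X_int[OF s]])
      show "AE \<omega> in M. norm (V \<omega> powr s) \<le> norm (X \<omega> powr s)"
        using X_pos U_pos
      proof eventually_elim
        case (elim \<omega>)
        then have "X \<omega> \<le> V \<omega>" unfolding V by simp
        then show ?case using elim False by (simp add: powr_mono2')
      qed
    qed simp
  qed
  \<comment> \<open>Taking expectations, that is the whole line as Borel set, makes
    \<open>\<alpha> s\<close> a quotient of two strictly positive moments of
    \<open>V\<close>.\<close>
  have \<alpha>_pos: "\<alpha> s > 0" if s: "s \<in> {r, r + 1}" for s
  proof -
    have s': "s \<in> {r - 1, r, r + 1}" "s - 1 \<in> {r - 1, r, r + 1}" using s by auto
    have V_eq: "(LINT \<omega>|M. V \<omega> powr s) = \<alpha> s * (LINT \<omega>|M. V \<omega> powr (s - 1))"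
      using set_integral_cond_exp_given_proportional[OF prob U_meas V_int[OF s'(1)] V_int[OF s'(2)]
        regression[rule_format, OF s], of UNIV]
      by (simp add: set_integral_space[OF V_int[OF s'(1)]] set_integral_space[OF V_int[OF s'(2)]])
    have V_powr_pos: "(LINT \<omega>|M. V \<omega> powr t) > 0" if t: "t \<in> {r - 1, r, r + 1}" for t
    proof -
      have "(LINT \<omega>|M. V \<omega> powr t) \<noteq> 0"
      proof
        assume "(LINT \<omega>|M. V \<omega> powr t) = 0"
        then have "AE \<omega> in M. V \<omega> powr t = 0"
          using integral_nonneg_eq_0_iff_AE[OF V_int[OF t]] by simp
        with V_pos have "AE \<omega> in M. False" by eventually_elim simp
        then show False by simp
      qed
      moreover have "(LINT \<omega>|M. V \<omega> powr t) \<ge> 0" by simp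
      ultimately show ?thesis by linarith
    qed
    from V_powr_pos[OF s'(1)] V_powr_pos[OF s'(2)] show ?thesis unfolding V_eq by (rule zero_less_mult_pos2)
  qed

  \<comment> \<open>Passage to the laws of \<open>X\<close> and \<open>Y\<close>\<close>
  define \<mu> where "\<mu> = distr M borel X"
  define \<nu> where "\<nu> = distr M borel Y"
  have \<mu>: "prob_space \<mu>" "sets \<mu> = sets borel" "AE x in \<mu>. x > 0"
    unfolding \<mu>_def using X_pos by (auto intro: prob_space_distr simp: AE_distr_iff)
  have \<nu>: "prob_space \<nu>" "sets \<nu> = sets borel" "AE y in \<nu>. y > 0"
    unfolding \<nu>_def using Y_pos by (auto intro: prob_space_distr simp: AE_distr_iff)
  have joint: "(\<integral>\<^sup>+\<omega>. f (X \<omega>) (Y \<omega>) \<partial>M) = (\<integral>\<^sup>+x. \<integral>\<^sup>+y. f x y \<partial>\<nu> \<partial>\<mu>)"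
    if [measurable]: "case_prod f \<in> borel_measurable (borel \<Otimes>\<^sub>M borel)" for f
  proof -
    interpret \<nu>: prob_space \<nu> by (rule \<nu>)
    have "(\<integral>\<^sup>+\<omega>. f (X \<omega>) (Y \<omega>) \<partial>M) = (\<integral>\<^sup>+p. case_prod f p \<partial>distr M (borel \<Otimes>\<^sub>M borel) (\<lambda>\<omega>. (X \<omega>, Y \<omega>)))"
      by (subst nn_integral_distr) auto
    also have "\<dots> = (\<integral>\<^sup>+p. case_prod f p \<partial>(\<mu> \<Otimes>\<^sub>M \<nu>))"
      using indep unfolding indep_var_distribution_eq \<mu>_def \<nu>_def by simp
    also have "\<dots> = (\<integral>\<^sup>+x. \<integral>\<^sup>+y. f x y \<partial>\<nu> \<partial>\<mu>)"
      by (subst \<nu>.nn_integral_fst[symmetric]) (auto simp: measurable_cong_sets[OF sets_pair_measure_cong[OF \<mu>(2) \<nu>(2)] refl])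
    finally show ?thesis .
  qed
  have identity: "(\<integral>\<^sup>+x. \<integral>\<^sup>+y. h (y / (1 + x)) * ennreal ((1 + y / (1 + x)) * x powr s) \<partial>\<nu> \<partial>\<mu>)
      = ennreal (\<alpha> s) * (\<integral>\<^sup>+x. \<integral>\<^sup>+y. h (y / (1 + x)) * ennreal (x powr (s - 1)) \<partial>\<nu> \<partial>\<mu>)"
    if h [measurable]: "h \<in> borel_measurable borel" and s: "s \<in> {r, r + 1}" for h s
  proof -
    have s': "s \<in> {r - 1, r, r + 1}" "s - 1 \<in> {r - 1, r, r + 1}" using s by auto
    \<comment> \<open>A function of \<open>U\<close> may multiply both sides; the factor (1 + U)^(1
      - s) turns V^s into (1 + U) X^s and V^(s - 1) into X^(s - 1).\<close>
    define k where "k = (\<lambda>u. h u * ennreal ((1 + u) powr (1 - s)))"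
    have [measurable]: "k \<in> borel_measurable borel" unfolding k_def by measurable
    have V_powr: "(1 + U \<omega>) powr (1 - s) * V \<omega> powr t = (1 + U \<omega>) powr (1 - s + t) * X \<omega> powr t"
      if "X \<omega> > 0" "U \<omega> > 0" for \<omega> t
      using that unfolding V by (simp add: powr_mult powr_add mult_ac)
    have "(\<integral>\<^sup>+x. \<integral>\<^sup>+y. h (y / (1 + x)) * ennreal ((1 + y / (1 + x)) * x powr s) \<partial>\<nu> \<partial>\<mu>)
        = (\<integral>\<^sup>+\<omega>. h (U \<omega>) * ennreal ((1 + U \<omega>) * X \<omega> powr s) \<partial>M)"
      unfolding U
      by (rule joint[of "\<lambda>x y. h (y / (1 + x)) * ennreal ((1 + y / (1 + x)) * x powr s)", symmetric]) measurable
    also have "\<dots> = (\<integral>\<^sup>+\<omega>. k (U \<omega>) * ennreal (V \<omega> powr s) \<partial>M)"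
      by (rule nn_integral_cong_AE, use X_pos U_pos in eventually_elim)
        (simp add: k_def mult.assoc ennreal_mult'[symmetric] V_powr)
    also have "\<dots> = ennreal (\<alpha> s) * (\<integral>\<^sup>+\<omega>. k (U \<omega>) * ennreal (V \<omega> powr (s - 1)) \<partial>M)"
      using \<alpha>_pos[OF s] regression s
      by (intro nn_integral_cond_exp_given_proportional prob U_meas V_int s') auto
    also have "(\<integral>\<^sup>+\<omega>. k (U \<omega>) * ennreal (V \<omega> powr (s - 1)) \<partial>M)
        = (\<integral>\<^sup>+\<omega>. h (U \<omega>) * ennreal (X \<omega> powr (s - 1)) \<partial>M)"
      by (rule nn_integral_cong_AE, use X_pos U_pos in eventually_elim)
        (simp add: k_def mult.assoc ennreal_mult'[symmetric] V_powr)
    also have "\<dots> = (\<integral>\<^sup>+x. \<integral>\<^sup>+y. h (y / (1 + x)) * ennreal (x powr (s - 1)) \<partial>\<nu> \<partial>\<mu>)"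
      unfolding U by (rule joint[of "\<lambda>x y. h (y / (1 + x)) * ennreal (x powr (s - 1))"]) measurable
    finally show ?thesis .
  qed
  have \<mu>_fin: "(\<integral>\<^sup>+x. ennreal (x powr s) \<partial>\<mu>) < \<infinity>" if "s \<in> {r - 1, r, r + 1}" for s
    unfolding \<mu>_def using X_int[OF that] by (simp add: nn_integral_distr integrable_iff_bounded)
  have \<nu>_nondeg: "\<not> (AE y in \<nu>. y = k)" for k
    using Y_nondeg unfolding \<nu>_def non_degenerate_def by (simp add: AE_distr_iff)

  \<comment> \<open>Identification of the gamma and Kummer laws\<close>
  define \<delta> where "\<delta> = \<alpha> (r + 1) - \<alpha> r"
  have \<alpha>_pos': "\<alpha> r > 0" "\<alpha> (r + 1) > 0" using \<alpha>_pos by auto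
  note rec = moment_recurrence[OF \<mu>(1) \<nu>(1) \<mu>(2) \<nu>(2) \<mu>(3) \<nu>(3) \<nu>_nondeg \<alpha>_pos' \<mu>_fin identity, folded \<delta>_def]
  have \<delta>: "\<delta> > 0" using rec(1) by blast
  obtain c where c: "c > 0" and moments: "\<And>n. (\<integral>\<^sup>+y. ennreal (y ^ Suc n) \<partial>\<nu>)
      = ennreal ((c + real n) * \<delta>) * (\<integral>\<^sup>+y. ennreal (y ^ n) \<partial>\<nu>)"
    using rec(2) by blast
  have l: "1 / \<delta> > 0" using \<delta> by simp
  have \<nu>_eq: "\<nu> = density lborel (\<lambda>y. ennreal (normalized (gamma_kernel c (1 / \<delta>)) y))"
    by (rule gamma_distribution_unique[OF \<nu> c l]) (use moments in simp)
  \<comment> \<open>For \<open>s = r + 1\<close> the lower power is x^r, whose integral over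
    \<open>\<mu>\<close> is finite by \<open>\<mu>_fin\<close>, as the Kummer characterization
    requires.\<close>
  have "AE u in lborel. u > 0 \<longrightarrow>
      ennreal (1 + u) * (\<integral>\<^sup>+x. ennreal (x powr (r + 1) * (1 + x) powr c * exp (- (1 / \<delta> * u * x))) \<partial>\<mu>)
      = ennreal (\<alpha> (r + 1)) * (\<integral>\<^sup>+x. ennreal (x powr r * (1 + x) powr c * exp (- (1 / \<delta> * u * x))) \<partial>\<mu>)"
    using laplace_equation[OF \<mu> c l \<nu>_eq identity, of "r + 1"] by simp
  note \<mu>_eq = kummer_distribution_unique[OF \<mu> c l \<alpha>_pos'(2) \<mu>_fin this, simplified]
  \<comment> \<open>\<open>distributed\<close> pushes forward to \<open>lborel\<close>, the laws
    above to \<open>borel\<close>; \<open>distr\<close> sees only the \<sigma>-algebra of its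
    target, and these coincide.\<close>
  have distr_lborel: "distr M lborel Z = distr M borel Z" for Z :: "'a \<Rightarrow> real"
    by (rule distr_cong) auto
  have "kummer_distributed M X (\<alpha> (r + 1) / \<delta> - r) (c - \<alpha> (r + 1) / \<delta> + r) (1 / \<delta>)"
    using \<mu>_eq l unfolding kummer_distributed_def distributed_def \<mu>_def
    by (simp add: distr_lborel normalized_def)
  moreover have "gamma_distributed M Y c (1 / \<delta>)"
    using \<nu>_eq c l unfolding gamma_distributed_def distributed_def \<nu>_def
    by (simp add: distr_lborel normalized_def)
  ultimately show ?thesis
    using \<delta> c \<mu>_eq(1) unfolding \<delta>_def by auto
qed

end
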